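(* Let $d\in\{2,3,\ldots\}$, $\nu:=(d-3)/2$, $\beta>0$, and $s\in\mathbb{C}$ with $\operatorname{Re}s>0$. Let $g_\nu$, $\psi_{\nu,s}$, the reflection $\mathbf{R}$, the half-space $H_+$ and its boundary $H_0$ be as defined in the context. Set, for $\mathbf{z}\in H_+$, \[ G_{\mathrm{imp}}(\mathbf{z}) := -\frac{\beta}{\pi}\left(\frac{s^{2}}{2\pi}\right)^{\nu+1/2} e^{-s\|\mathbf{z}\|}\,\psi_{\nu,s}(\mathbf{z}), \] and \[ G(\mathbf{x},\mathbf{y}) := g_\nu(\|\mathbf{x}-\mathbf{y}\|)+g_\nu(\|\mathbf{x}-\mathbf{R}\mathbf{y}\|)+G_{\mathrm{imp}}(\mathbf{x}-\mathbf{R}\mathbf{y}). \] Then $G$ is the Green's function for the acoustic half-space problem with impedance boundary conditions, i.e. it solves \[ \begin{array}{rll} -\Delta_{\mathbf{x}}G(\mathbf{x},\mathbf{y})+s^{2}G(\mathbf{x},\mathbf{y}) &=\delta_0(\mathbf{x}-\mathbf{y}) & \text{for }(\mathbf{x},\mathbf{y})\in H_+\times H_+,\\[2pt] \dfrac{\partial}{\partial \mathbf{n}_{\mathbf{x}}}G(\mathbf{x},\mathbf{y})+s\beta\, G(\mathbf{x},\mathbf{y}) &=0 & \text{for }(\mathbf{x},\mathbf{y})\in H_0\times H_+,\\[4pt] G(\rho\,\boldsymbol{\zeta},\mathbf{y}) &\to 0 \ \text{ as } \rho\to+\infty & \text{for }(\boldsymbol{\zeta},\mathbf{y})\in H_+\times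 H_+, \end{array} \] where the first equation is understood in the sense of distributions in $\mathbf{x}$.
   Context: $H_+=\{\mathbf{x}\in\mathbb{R}^d: x_d>0\}$, $H_0=\partial H_+=\{\mathbf{x}\in\mathbb{R}^d: x_d=0\}$, with outward unit normal $\mathbf{n}=(0,\ldots,0,-1)^T$, so $\partial/\partial\mathbf{n}_{\mathbf{x}}=-\partial/\partial x_d$. $\|\cdot\|$ is the Euclidean norm, and $\delta_0$ is the Dirac distribution at $0$. For $\mathbf{z}\in\mathbb{R}^d$ write $\mathbf{z}'=(z_1,\ldots,z_{d-1})$. For $\mathbf{y}\in H_+$, $\mathbf{R}\mathbf{y}=(\mathbf{y}',-y_d)$. Note that $\mathbf{x}-\mathbf{R}\mathbf{y}\in H_+$ for $\mathbf{x}\in H_+\cup H_0$ and $\mathbf{y}\in H_+$. $K_\lambda$ is the modified Bessel function of the second kind (Macdonald function) of order $\lambda$. Complex powers are principal branches (so $(s^2)^{\nu+1/2}=s^{2\nu+1}$ for $\operatorname{Re}s>0$). For $\rho>0$, \[ g_\nu(\rho):=\frac{1}{(2\pi)^{\nu+3/2}}\left(\frac{s}{\rho}\right)^{\nu+1/2}K_{\nu+1/2}(s\rho); \] $g_\nu(\|\mathbf{x}-\mathbf{y}\|)$ is the full-space Green's function of $-\Delta+s^2$ in $\mathbb{R}^d$. For $\mathbf{z}\in H_+$ let $\mu(\mathbf{z}',t):=\sqrt{\|\mathbf{z}'\|^2+t^2}$ and define \[ y(\mathbf{z},\cdot):[z_d,\infty)\to[0,\infty),\qquad y(\mathbf{z},t):=-(\|\mathbf{z}\|+\beta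 z_d)+\beta t+\mu(\mathbf{z}',t). \] This is a strictly increasing bijection; denote its inverse by $t(\mathbf{z},\cdot):[0,\infty)\to[z_d,\infty)$, and set $\tilde\mu(\mathbf{z},y):=\mu(\mathbf{z}',t(\mathbf{z},y))$. With the abbreviations $t=t(\mathbf{z},y)$ and $\tilde\mu=\tilde\mu(\mathbf{z},y)$, \[ \psi_{\nu,s}(\mathbf{z}):=\int_0^\infty \frac{e^{-sy}}{t+\beta\tilde\mu}\,\frac{e^{s\tilde\mu}K_{\nu+1/2}(s\tilde\mu)}{(s\tilde\mu)^{\nu-1/2}}\,dy, \] an improper Riemann integral that exists for $\operatorname{Re}s>0$. (For $s\in\mathrm{i}\mathbb{R}\setminus\{0\}$ the problem, its Green's function and $\psi_{\nu,s}$ are by definition understood as the limits $\sigma\to s$ with $\operatorname{Re}\sigma>0$.) *)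

theory Defs
  imports "HOL-Analysis.Analysis"
begin

definition last_index :: "'n::{finite,linorder}" where
  "last_index = Max UNIV"

definition half_space :: "(real^'n::{finite,linorder}) set" where
  "half_space = {x. x $ last_index > 0}"

definition half_space_boundary :: "(real^'n::{finite,linorder}) set" where
  "half_space_boundary = {x. x $ last_index = 0}"

definition outward_normal :: "real^'n::{finite,linorder}" where
  "outward_normal = - axis last_index 1"

definition reflect :: "real^'n::{finite,linorder} \<Rightarrow> real^'n::{finite,linorder}" where
  "reflect y = (\<chi> i. if i = last_index then - (y $ i) else y $ i)"

text \<open>
  The vector \<open>z' = (z\<^sub>1, \<dots>, z\<^bsub>d-1\<^esub>)\<close> is kept in \<open>\<real>\<^sup>d\<close>, with last coordinate 0.
  Only its Euclidean norm is used below, and that is unaffected.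
\<close>
definition tangential :: "real^'n::{finite,linorder} \<Rightarrow> real^'n::{finite,linorder}" where
  "tangential z = (\<chi> i. if i = last_index then 0 else z $ i)"

text \<open>
  The Macdonald function of real order, by its standard integral representation
  \<open>K\<^sub>\<kappa>(z) = \<integral>\<^sub>0\<^sup>\<infinity> exp (- z cosh u) cosh (\<kappa> u) du\<close> (DLMF 10.32.9), valid for \<open>Re z > 0\<close>.
  Below, \<open>z\<close> is always \<open>s\<close> times a positive real with \<open>Re s > 0\<close>.
\<close>
definition macdonald :: "real \<Rightarrow> complex \<Rightarrow> complex" where
  "macdonald \<kappa> z =
     integral {0..} (\<lambda>u. exp (- z * of_real (cosh u)) * of_real (cosh (\<kappa> * u)))"

text \<open>Complex powers are \<^const>\<open>powr\<close>, i.e. principal branches.\<close>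
definition g_full :: "real \<Rightarrow> complex \<Rightarrow> real \<Rightarrow> complex" where
  "g_full \<nu> s \<rho> =
     of_real (1 / (2 * pi) powr (\<nu> + 3/2))
     * (s / of_real \<rho>) powr of_real (\<nu> + 1/2) * macdonald (\<nu> + 1/2) (s * of_real \<rho>)"

definition mu :: "real^'n::{finite,linorder} \<Rightarrow> real \<Rightarrow> real" where
  "mu z t = sqrt ((norm (tangential z))\<^sup>2 + t\<^sup>2)"

definition y_map :: "real \<Rightarrow> real^'n::{finite,linorder} \<Rightarrow> real \<Rightarrow> real" where
  "y_map \<beta> z t = - (norm z + \<beta> * z $ last_index) + \<beta> * t + mu z t"

definition t_map :: "real \<Rightarrow> real^'n::{finite,linorder} \<Rightarrow> real \<Rightarrow> real" where
  "t_map \<beta> z = the_inv_into {z $ last_index..} (y_map \<beta> z)"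

definition mu_tilde :: "real \<Rightarrow> real^'n::{finite,linorder} \<Rightarrow> real \<Rightarrow> real" where
  "mu_tilde \<beta> z y = mu z (t_map \<beta> z y)"

text \<open>
  The Henstock--Kurzweil integral over \<open>[0, \<infinity>)\<close> extends the improper Riemann integral.
\<close>
definition psi :: "real \<Rightarrow> real \<Rightarrow> complex \<Rightarrow> real^'n::{finite,linorder} \<Rightarrow> complex" where
  "psi \<nu> \<beta> s z =
     integral {0..} (\<lambda>y.
       exp (- s * of_real y) / of_real (t_map \<beta> z y + \<beta> * mu_tilde \<beta> z y)
       * (exp (s * of_real (mu_tilde \<beta> z y))
            * macdonald (\<nu> + 1/2) (s * of_real (mu_tilde \<beta> z y))
          / (s * of_real (mu_tilde \<beta> z y)) powr of_real (\<nu> - 1/2)))"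

definition G_imp :: "real \<Rightarrow> real \<Rightarrow> complex \<Rightarrow> real^'n::{finite,linorder} \<Rightarrow> complex" where
  "G_imp \<nu> \<beta> s z =
     - of_real (\<beta> / pi) * (s\<^sup>2 / of_real (2 * pi)) powr of_real (\<nu> + 1/2)
     * exp (- s * of_real (norm z)) * psi \<nu> \<beta> s z"

definition G_half ::
  "real \<Rightarrow> real \<Rightarrow> complex \<Rightarrow> real^'n::{finite,linorder} \<Rightarrow> real^'n::{finite,linorder} \<Rightarrow> complex" where
  "G_half \<nu> \<beta> s x y =
     g_full \<nu> s (norm (x - y)) + g_full \<nu> s (norm (x - reflect y)) + G_imp \<nu> \<beta> s (x - reflect y)"

definition partial_deriv :: "'n::finite \<Rightarrow> (real^'n \<Rightarrow> complex) \<Rightarrow> real^'n \<Rightarrow> complex" where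
  "partial_deriv i f x = vector_derivative (\<lambda>h. f (x + h *\<^sub>R axis i 1)) (at 0)"

fun C_k :: "nat \<Rightarrow> (real^'n \<Rightarrow> complex) \<Rightarrow> bool" where
  "C_k 0 f \<longleftrightarrow> continuous_on UNIV f"
| "C_k (Suc k) f \<longleftrightarrow> (\<forall>x. f differentiable (at x)) \<and> (\<forall>i. C_k k (partial_deriv i f))"

definition test_function :: "(real^'n) set \<Rightarrow> (real^'n \<Rightarrow> complex) \<Rightarrow> bool" where
  "test_function U \<phi> \<longleftrightarrow>
     (\<forall>k. C_k k \<phi>) \<and> compact (closure {x. \<phi> x \<noteq> 0}) \<and> closure {x. \<phi> x \<noteq> 0} \<subseteq> U"

definition laplacian :: "(real^'n \<Rightarrow> complex) \<Rightarrow> real^'n \<Rightarrow> complex" where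
  "laplacian \<phi> x = (\<Sum>i\<in>UNIV. partial_deriv i (partial_deriv i \<phi>) x)"

definition locally_integrable :: "(real^'n) set \<Rightarrow> (real^'n \<Rightarrow> complex) \<Rightarrow> bool" where
  "locally_integrable U f \<longleftrightarrow> (\<forall>K. compact K \<and> K \<subseteq> U \<longrightarrow> set_integrable lborel K f)"

text \<open>
  A distribution is represented by its (bilinear) action on test functions.
\<close>
definition regular_distribution ::
  "(real^'n) set \<Rightarrow> (real^'n \<Rightarrow> complex) \<Rightarrow> (real^'n \<Rightarrow> complex) \<Rightarrow> complex" where
  "regular_distribution U f \<phi> = (LINT x:U|lborel. f x * \<phi> x)"

definition laplacian_distribution ::
  "((real^'n \<Rightarrow> complex) \<Rightarrow> complex) \<Rightarrow> (real^'n \<Rightarrow> complex) \<Rightarrow> complex" where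
  "laplacian_distribution T \<phi> = T (laplacian \<phi>)"

text \<open>\<open>dirac y\<close> is \<open>\<delta>\<^sub>0(x - y)\<close> as a distribution in \<open>x\<close>.\<close>
definition dirac :: "real^'n \<Rightarrow> (real^'n \<Rightarrow> complex) \<Rightarrow> complex" where
  "dirac y \<phi> = \<phi> y"

lemma norm_eq_mu: "norm z = mu z (z $ last_index)"
proof -
  have "(norm z)\<^sup>2 = (norm (tangential z))\<^sup>2 + (z $ last_index)\<^sup>2"
    unfolding norm_vec_def L2_set_def tangential_def
    by (simp add: sum_nonneg sum.remove[of UNIV last_index])
  then show ?thesis
    unfolding mu_def by (metis norm_ge_zero real_sqrt_unique)
qed

lemma bij_betw_y_map:
  assumes "\<beta> > 0" and "z \<in> half_space"
  shows "bij_betw (y_map \<beta> z) {z $ last_index..} {0..}"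
proof -
  let ?a = "z $ last_index"
  have a: "?a > 0"
    using assms by (simp add: half_space_def)
  have zero: "y_map \<beta> z ?a = 0"
    by (simp add: y_map_def norm_eq_mu)
  have less: "y_map \<beta> z u < y_map \<beta> z v" if "?a \<le> u" "u < v" for u v
  proof -
    have "u\<^sup>2 \<le> v\<^sup>2"
      using that a by (intro power_mono) auto
    moreover have "\<beta> * u < \<beta> * v"
      using that assms by simp
    ultimately show ?thesis
      by (simp add: y_map_def mu_def add_less_le_mono)
  qed
  have inj: "inj_on (y_map \<beta> z) {?a..}"
    by (rule linorder_inj_onI) (use less in force)+
  have nonneg: "y_map \<beta> z t \<ge> 0" if "t \<ge> ?a" for t
    using that less[of ?a t] zero by (cases "t = ?a") auto
  have surj: "\<exists>t\<ge>?a. y_map \<beta> z t = y" if "y \<ge> 0" for y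
  proof -
    let ?b = "?a + (y + norm z) / \<beta>"
    have "y_map \<beta> z ?b \<ge> y"
      using assms by (simp add: y_map_def mu_def field_simps)
    moreover have "continuous_on {?a..?b} (y_map \<beta> z)"
      unfolding y_map_def mu_def by (intro continuous_intros)
    moreover have "?a \<le> ?b"
      using that assms by simp
    ultimately show ?thesis
      using IVT'[of "y_map \<beta> z" ?a y ?b] zero that by auto
  qed
  show ?thesis
    unfolding bij_betw_def using inj nonneg surj by fastforce
qed

end

(*
  With kappa = d/2 - 1, translating the variable of the integral representation of K_kappa gives
    g(x) = (1/s) * integral over w of exp w * exp (- s exp w) * heat s w x,
  where heat s w is the heat kernel at the complex time exp w / s. So for a test function phi and any
  centre a the integral of g(x - a) (s^2 phi - Laplace phi) is the increment over the real w-line of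
  - exp (- s exp w) * (heat s w * phi)(a), i.e. phi(a). The kernel is dominated absolutely because
  Re s > 0, so no other property of Bessel functions is needed.

  Substituting y = y(z, t) in psi turns the impedance part into
    G_imp(z) = - 2 beta s * integral over tau >= 0 of exp (- s beta tau) g(z + tau e_d),
  a superposition of point sources at R y - tau e_d, all outside the half-space. Hence it contributes
  nothing to the distributional equation, and it satisfies
  (d/dz_d - s beta) G_imp = 2 beta s g, which balances the Robin data 2 s beta g of the two
  mirror-symmetric sources on the boundary.
*)

theory Submission
  imports Defs "HOL-Probability.Distributions"
begin

text \<open>The resolvent (s^2 - Laplace)^(-1) is the Laplace transform of the heat semigroup, an
  integral of exp (- s^2 t) over t > 0, but for |arg s| >= pi/4 this fails on the real time axis
  because Re (s^2) <= 0. Time is therefore taken on the ray t = v / s with v > 0: there s^2 t = s v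
  and |x|^2 / (4 t) = s |x|^2 / (4 v), so both exponentials decay as soon as Re s > 0. The price is
  that the heat kernel is no longer positive: that its total integral is 1 rests on complex Gaussian
  integrals, and uniform bounds come from its L1 norm, which does not depend on v. The logarithmic
  variable w = ln v turns the two ends of the ray into the two ends of the line and makes the Bessel
  integral a mere translate of the kernel integral. The singularity of g is never analysed:
  integrability comes from Fubini, and pointwise a crude power bound is enough for the ray of
  sources and for the decay at infinity.\<close>

section \<open>Differentiation under the integral\<close>

text \<open>Turns derivatives into limits of quotients, the form to which dominated convergence
  applies.\<close>

lemma has_vector_derivative_at_iff_quotient:
  "(f has_vector_derivative D) (at x) \<longleftrightarrow> ((\<lambda>h. (f (x + h) - f x) /\<^sub>R h) \<longlongrightarrow> D) (at 0)"
proof -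
  have *: "norm (f (x + h) - f x - h *\<^sub>R D) / norm h = norm ((f (x + h) - f x) /\<^sub>R h - D)"
    if "h \<noteq> 0" for h
  proof -
    have "(f (x + h) - f x) /\<^sub>R h - D = (f (x + h) - f x - h *\<^sub>R D) /\<^sub>R h"
      using that by (simp add: scaleR_diff_right)
    then show ?thesis
      by (simp only: norm_scaleR) (simp add: field_simps)
  qed
  have "((\<lambda>h. norm (f (x + h) - f x - h *\<^sub>R D) / norm h) \<longlongrightarrow> 0) (at 0) \<longleftrightarrow>
        ((\<lambda>h. norm ((f (x + h) - f x) /\<^sub>R h - D)) \<longlongrightarrow> 0) (at 0)"
    by (intro Lim_cong_within refl) (rule *)
  also have "\<dots> \<longleftrightarrow> ((\<lambda>h. (f (x + h) - f x) /\<^sub>R h) \<longlongrightarrow> D) (at 0)"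
    by (simp only: tendsto_norm_zero_iff LIM_zero_iff)
  finally show ?thesis
    unfolding has_vector_derivative_def has_derivative_at
    by (simp only: bounded_linear_scaleR_left simp_thms)
qed

text \<open>Dominated convergence for difference quotients: the mean value inequality turns the
  bound on \<open>f'\<close> into the same bound on the quotients. Convergence at 0 is tested along
  sequences, which also makes \<open>f' t0\<close> measurable as a pointwise limit.\<close>

lemma has_vector_derivative_integral:
  fixes f :: "real \<Rightarrow> 'a \<Rightarrow> 'b::{banach,second_countable_topology}"
  assumes \<delta>: "\<delta> > 0"
    and int: "\<And>t. t \<in> ball t0 \<delta> \<Longrightarrow> integrable M (f t)"
    and der: "\<And>t x. t \<in> ball t0 \<delta> \<Longrightarrow> ((\<lambda>t. f t x) has_vector_derivative f' t x) (at t)"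
    and bound: "\<And>t x. t \<in> ball t0 \<delta> \<Longrightarrow> norm (f' t x) \<le> g x"
    and g: "integrable M g"
  shows "((\<lambda>t. \<integral>x. f t x \<partial>M) has_vector_derivative (\<integral>x. f' t0 x \<partial>M)) (at t0)"
proof -
  let ?q = "\<lambda>h x. (f (t0 + h) x - f t0 x) /\<^sub>R h"
  have t0: "t0 \<in> ball t0 \<delta>" using \<delta> by simp
  have q_lim: "((\<lambda>h. ?q h x) \<longlongrightarrow> f' t0 x) (at 0)" for x
    using der[OF t0, of x] by (simp only: has_vector_derivative_at_iff_quotient)
  have q_bound: "norm (?q h x) \<le> g x" if h: "\<bar>h\<bar> < \<delta>" for h x
  proof (cases "h = 0")
    case True
    have "0 \<le> g x" using bound[OF t0, of x] norm_ge_zero order_trans by blast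
    with True show ?thesis by simp
  next
    case False
    have "norm (f (t0 + h) x - f t0 x) \<le> g x * norm (t0 + h - t0)"
    proof (rule differentiable_bound[where S="ball t0 \<delta>" and f="\<lambda>t. f t x" and f'="\<lambda>t h. h *\<^sub>R f' t x"])
      show "((\<lambda>t. f t x) has_derivative (\<lambda>h. h *\<^sub>R f' t x)) (at t within ball t0 \<delta>)"
        if "t \<in> ball t0 \<delta>" for t
        using der[OF that] unfolding has_vector_derivative_def by (rule has_derivative_at_withinI)
      show "onorm (\<lambda>h. h *\<^sub>R f' t x) \<le> g x" if "t \<in> ball t0 \<delta>" for t
      proof (rule onorm_bound)
        show "0 \<le> g x" using order_trans[OF norm_ge_zero bound[OF that]] .
        show "norm (h *\<^sub>R f' t x) \<le> g x * norm h" for h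
          using mult_left_mono[OF bound[OF that], of "norm h"] by (simp add: mult.commute)
      qed
      show "t0 + h \<in> ball t0 \<delta>" using h by (simp add: dist_norm)
    qed (use \<delta> in auto)
    with False show ?thesis
      by (simp only: norm_scaleR) (simp add: field_simps)
  qed
  have q_meas: "?q h \<in> borel_measurable M" if "\<bar>h\<bar> < \<delta>" for h
  proof -
    have "t0 + h \<in> ball t0 \<delta>" using that by (simp add: dist_norm)
    from borel_measurable_integrable[OF int[OF this]] borel_measurable_integrable[OF int[OF t0]]
    show ?thesis by measurable
  qed
  have q_int: "(\<integral>x. ?q h x \<partial>M) = ((\<integral>x. f (t0 + h) x \<partial>M) - (\<integral>x. f t0 x \<partial>M)) /\<^sub>R h" if "\<bar>h\<bar> < \<delta>" for h
  proof -
    have "t0 + h \<in> ball t0 \<delta>" using that by (simp add: dist_norm)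
    then show ?thesis using int t0 by simp
  qed
  have "((\<lambda>h. ((\<integral>x. f (t0 + h) x \<partial>M) - (\<integral>x. f t0 x \<partial>M)) /\<^sub>R h) \<longlongrightarrow> (\<integral>x. f' t0 x \<partial>M)) (at 0)"
    unfolding tendsto_at_iff_sequentially comp_def
  proof (intro allI impI)
    fix X :: "nat \<Rightarrow> real" assume X0: "\<forall>i. X i \<in> UNIV - {0}" and X: "X \<longlonglongrightarrow> 0"
    \<comment> \<open>The quotients are controlled only for increments below
      \<open>\<delta>\<close>, so an initial segment of the sequence is cut off.\<close>
    from LIMSEQ_D[OF X \<delta>] obtain K where K: "\<And>n. n \<ge> K \<Longrightarrow> \<bar>X n\<bar> < \<delta>"
      by auto
    let ?s = "\<lambda>n. ?q (X (n + K))"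
    have lim: "(\<lambda>n. ?s n x) \<longlonglongrightarrow> f' t0 x" for x
    proof -
      have "(\<lambda>n. ?q (X n) x) \<longlonglongrightarrow> f' t0 x"
        using q_lim[of x] X0 X unfolding tendsto_at_iff_sequentially comp_def by blast
      from LIMSEQ_ignore_initial_segment[OF this, of K] show ?thesis .
    qed
    have sm: "?s n \<in> borel_measurable M" for n by (rule q_meas) (simp add: K)
    have "(\<lambda>n. \<integral>x. ?s n x \<partial>M) \<longlonglongrightarrow> (\<integral>x. f' t0 x \<partial>M)"
    proof (rule integral_dominated_convergence[where w=g])
      show "f' t0 \<in> borel_measurable M"
        by (rule borel_measurable_LIMSEQ_metric[OF sm]) (rule lim)
    qed (use sm g lim q_bound K in auto)
    then have "(\<lambda>n. ((\<integral>x. f (t0 + X (n + K)) x \<partial>M) - (\<integral>x. f t0 x \<partial>M)) /\<^sub>R X (n + K)) \<longlonglongrightarrow> (\<integral>x. f' t0 x \<partial>M)"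
      by (subst (asm) q_int) (use K in auto)
    then show "(\<lambda>n. ((\<integral>x. f (t0 + X n) x \<partial>M) - (\<integral>x. f t0 x \<partial>M)) /\<^sub>R X n) \<longlonglongrightarrow> (\<integral>x. f' t0 x \<partial>M)"
      by (rule LIMSEQ_offset)
  qed
  then show ?thesis
    by (simp only: has_vector_derivative_at_iff_quotient)
qed

section \<open>Complex Gaussian integrals\<close>

text \<open>Integrability is an equivalence because the inverse of an affine map is affine. Hence
  the integral formula holds for every \<open>f\<close>: if \<open>f\<close> is not integrable, both
  sides have the default value 0.\<close>

lemma
  fixes f :: "'a::euclidean_space \<Rightarrow> 'b::{banach,second_countable_topology}"
  assumes c: "c \<noteq> 0"
  shows integrable_lborel_affine_iff:
      "integrable lborel (\<lambda>x. f (t + c *\<^sub>R x)) \<longleftrightarrow> integrable lborel f" (is ?int)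
    and integral_lborel_affine:
      "(\<integral>x. f x \<partial>lborel) = \<bar>c\<bar> ^ DIM('a) *\<^sub>R (\<integral>x. f (t + c *\<^sub>R x) \<partial>lborel)" (is ?eq)
proof -
  have imp: "integrable lborel (\<lambda>x. g (u + e *\<^sub>R x))" if g: "integrable lborel g" and e: "e \<noteq> 0"
    for g :: "'a \<Rightarrow> 'b" and u e
  proof -
    have [measurable]: "g \<in> borel_measurable borel" using borel_measurable_integrable[OF g] by simp
    have "integrable (density (distr lborel borel (\<lambda>x. u + e *\<^sub>R x)) (\<lambda>_. ennreal (\<bar>e\<bar> ^ DIM('a)))) g"
      using g lborel_affine[OF e, of u] by (simp add: ennreal_power)
    then have "integrable lborel (\<lambda>x. \<bar>e\<bar> ^ DIM('a) *\<^sub>R g (u + e *\<^sub>R x))"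
      by (subst (asm) integrable_density) (auto simp: integrable_distr_eq)
    from integrable_scaleR_right[OF this, of "inverse (\<bar>e\<bar> ^ DIM('a))"] e show ?thesis by simp
  qed
  show ?int
  proof
    assume "integrable lborel (\<lambda>x. f (t + c *\<^sub>R x))"
    from imp[OF this, of "1/c" "- (1/c) *\<^sub>R t"] c show "integrable lborel f"
      by (simp add: algebra_simps)
  qed (use imp c in auto)
  show ?eq
  proof (cases "integrable lborel f")
    case True
    then have [measurable]: "f \<in> borel_measurable borel"
      using borel_measurable_integrable by force
    have "(\<integral>x. f x \<partial>lborel) =
        (\<integral>x. f x \<partial>density (distr lborel borel (\<lambda>x. t + c *\<^sub>R x)) (\<lambda>_. ennreal (\<bar>c\<bar> ^ DIM('a))))"
      using lborel_affine[OF c, of t] by (simp add: ennreal_power)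
    also have "\<dots> = (\<integral>x. \<bar>c\<bar> ^ DIM('a) *\<^sub>R f (t + c *\<^sub>R x) \<partial>lborel)"
      by (subst integral_density) (auto simp: integral_distr)
    finally show ?thesis by simp
  next
    case False
    then show ?thesis using \<open>?int\<close> by (simp add: not_integrable_integral_eq)
  qed
qed

text \<open>A Gaussian in \<open>norm x\<close> is a product over the coordinates; this reduces its
  integral to dimension one.\<close>

lemma
  fixes f :: "'a::euclidean_space \<Rightarrow> real \<Rightarrow> 'b::{real_normed_field,banach,second_countable_topology}"
  assumes "\<And>b. b \<in> Basis \<Longrightarrow> integrable lborel (f b)"
  shows integrable_lborel_prod_Basis: "integrable lborel (\<lambda>x. \<Prod>b\<in>Basis. f b (x \<bullet> b))" (is ?int)
    and integral_lborel_prod_Basis: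
      "(\<integral>x. (\<Prod>b\<in>Basis. f b (x \<bullet> b)) \<partial>lborel) = (\<Prod>b\<in>Basis. \<integral>x. f b x \<partial>lborel)" (is ?eq)
proof -
  interpret product_sigma_finite "\<lambda>_::'a. lborel :: real measure"
    by standard
  have [measurable]: "f b \<in> borel_measurable borel" if "b \<in> Basis" for b
    using borel_measurable_integrable[OF assms[OF that]] by simp
  have meas: "(\<lambda>x. \<Prod>b\<in>Basis. f b (x \<bullet> b)) \<in> borel_measurable borel"
    by measurable
  have T: "(\<lambda>g. \<Sum>b\<in>Basis. g b *\<^sub>R b) \<in> (\<Pi>\<^sub>M b\<in>Basis. lborel) \<rightarrow>\<^sub>M (borel :: 'a measure)"
    by measurable
  have eq: "(\<Prod>b\<in>Basis. f b ((\<Sum>b\<in>Basis. g b *\<^sub>R b) \<bullet> b)) = (\<Prod>b\<in>Basis. f b (g b))" for g :: "'a \<Rightarrow> real"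
    by (intro prod.cong refl) simp
  show ?int
    by (subst lborel_eq) (use meas T product_integrable_prod[OF finite_Basis assms] in \<open>simp add: integrable_distr_eq eq\<close>)
  show ?eq
    by (subst lborel_eq) (use meas T product_integral_prod[OF finite_Basis assms] in \<open>simp add: integral_distr eq\<close>)
qed

lemma integrable_gaussian_even_moment:
  assumes \<sigma>: "\<sigma> > (0::real)"
  shows "integrable lborel (\<lambda>x. x ^ (2 * k) * exp (- \<sigma> * x\<^sup>2))"
proof -
  have "integrable lborel (\<lambda>x::real. exp (- x\<^sup>2) * x ^ (2 * k))"
    using has_bochner_integral_even_function[OF gaussian_moment_even_pos[where k=k]]
    by (simp add: has_bochner_integral_iff)
  from lborel_integrable_real_affine[OF this, of "sqrt \<sigma>" 0] \<sigma>
  have "integrable lborel (\<lambda>x. sqrt \<sigma> ^ (2 * k) * (x ^ (2 * k) * exp (- \<sigma> * x\<^sup>2)))"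
    by (simp add: power_mult_distrib mult_ac)
  with \<sigma> show ?thesis
    by (subst (asm) integrable_mult_left_iff) auto
qed

lemma norm_exp_minus_mult_of_real: "norm (exp (- s * of_real r)) = exp (- Re s * r)"
  by (simp add: norm_exp_eq_Re)

lemma integrable_complex_gaussian:
  assumes s: "Re s > 0"
  shows "integrable lborel (\<lambda>x::real. exp (- s * of_real (x\<^sup>2)))"
proof (rule Bochner_Integration.integrable_bound)
  show "integrable lborel (\<lambda>x. exp (- Re s * x\<^sup>2))"
    using integrable_gaussian_even_moment[OF s, of 0] by simp
qed (simp_all add: norm_exp_minus_mult_of_real del: of_real_power)

text \<open>The complex parameter moves on a line so that differentiation in a real variable
  suffices. Two lines are used: the ray through \<open>s\<close>, for scaling, and the segment from
  1 to \<open>s\<close>.\<close>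

lemma complex_gaussian_path_derivative:
  assumes "Re (a + t0 *\<^sub>R c) > 0"
  shows "((\<lambda>t. \<integral>x. exp (- (a + t *\<^sub>R c) * of_real ((x::real)\<^sup>2)) \<partial>lborel) has_vector_derivative
      (\<integral>x. - c * of_real ((x::real)\<^sup>2) * exp (- (a + t0 *\<^sub>R c) * of_real (x\<^sup>2)) \<partial>lborel)) (at t0)"
proof -
  \<comment> \<open>For \<open>\<bar>t - t0\<bar> < \<delta>\<close> the real part of the parameter
    moves by at most \<open>m\<close>, half of its value at \<open>t0\<close>; the summand 1 in the
    denominator of \<open>\<delta>\<close> covers \<open>c = 0\<close>.\<close>
  define m where "m = Re (a + t0 *\<^sub>R c) / 2"
  define \<delta> where "\<delta> = m / (1 + norm c)"
  have m: "m > 0" using assms by (simp add: m_def)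
  have \<delta>: "\<delta> > 0" using m by (simp add: \<delta>_def add_pos_nonneg)
  have Re_ge: "Re (a + t *\<^sub>R c) \<ge> m" if "t \<in> ball t0 \<delta>" for t
  proof -
    have "\<bar>(t - t0) * Re c\<bar> \<le> \<delta> * (1 + norm c)"
      unfolding abs_mult using that abs_Re_le_cmod[of c]
      by (intro mult_mono) (auto simp: dist_real_def)
    also have "\<dots> = m"
      using norm_ge_zero[of c] by (simp add: \<delta>_def add_nonneg_eq_0_iff)
    finally have "\<bar>(t - t0) * Re c\<bar> \<le> m" .
    moreover have "Re (a + t *\<^sub>R c) = 2 * m + (t - t0) * Re c"
      by (simp add: m_def algebra_simps)
    ultimately show ?thesis by linarith
  qed
  show ?thesis
  proof (rule has_vector_derivative_integral[where \<delta>=\<delta> and g="\<lambda>x. norm c * (x\<^sup>2 * exp (- m * x\<^sup>2))"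
        and f'="\<lambda>t x. - c * of_real (x\<^sup>2) * exp (- (a + t *\<^sub>R c) * of_real (x\<^sup>2))"])
    fix t x assume t: "t \<in> ball t0 \<delta>"
    show "integrable lborel (\<lambda>x::real. exp (- (a + t *\<^sub>R c) * of_real (x\<^sup>2)))"
      using Re_ge[OF t] m by (intro integrable_complex_gaussian) linarith
    show "((\<lambda>t. exp (- (a + t *\<^sub>R c) * of_real (x\<^sup>2))) has_vector_derivative
        - c * of_real (x\<^sup>2) * exp (- (a + t *\<^sub>R c) * of_real (x\<^sup>2))) (at t)"
      unfolding scaleR_conv_of_real
      by (rule has_vector_derivative_real_field) (auto intro!: derivative_eq_intros)
    have "norm (- c * of_real (x\<^sup>2) * exp (- (a + t *\<^sub>R c) * of_real (x\<^sup>2)))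
        = norm c * (x\<^sup>2 * exp (- Re (a + t *\<^sub>R c) * x\<^sup>2))"
      unfolding norm_mult norm_exp_minus_mult_of_real by (simp add: norm_power)
    also have "\<dots> \<le> norm c * (x\<^sup>2 * exp (- m * x\<^sup>2))"
      using mult_right_mono[OF Re_ge[OF t], of "x\<^sup>2"]
      by (intro mult_left_mono iffD2[OF exp_le_cancel_iff]) (simp_all add: algebra_simps)
    finally show "norm (- c * of_real (x\<^sup>2) * exp (- (a + t *\<^sub>R c) * of_real (x\<^sup>2)))
        \<le> norm c * (x\<^sup>2 * exp (- m * x\<^sup>2))" .
  qed (use \<delta> integrable_gaussian_even_moment[OF m, of 1] in auto)
qed

text \<open>Let J be the Gaussian integral as a function of its parameter. Substituting x / sqrt t
  gives J(t s) = J(s) / sqrt t for t > 0. The identity is the derivative of this at t = 1, taken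
  once under the integral and once on the right.\<close>

lemma gaussian_second_moment:
  assumes s: "Re s > 0"
  shows "(\<integral>x. - s * of_real ((x::real)\<^sup>2) * exp (- s * of_real (x\<^sup>2)) \<partial>lborel) =
    - (1/2) * (\<integral>x. exp (- s * of_real ((x::real)\<^sup>2)) \<partial>lborel)"
proof -
  let ?J = "\<integral>x. exp (- s * of_real ((x::real)\<^sup>2)) \<partial>lborel"
  have scale: "(1 / sqrt t) *\<^sub>R ?J = (\<integral>x. exp (- (0 + t *\<^sub>R s) * of_real ((x::real)\<^sup>2)) \<partial>lborel)"
    if t: "t \<in> {0<..}" for t
  proof -
    have t': "t > 0" using t by simp
    have "(\<integral>x. exp (- (0 + t *\<^sub>R s) * of_real ((x::real)\<^sup>2)) \<partial>lborel)
      = \<bar>1 / sqrt t\<bar> *\<^sub>R (\<integral>x. exp (- (0 + t *\<^sub>R s) * of_real ((0 + 1 / sqrt t * x)\<^sup>2)) \<partial>lborel)"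
      by (rule lborel_integral_real_affine) (use t' in simp)
    also have "(\<lambda>x. exp (- (0 + t *\<^sub>R s) * of_real ((0 + 1 / sqrt t * x)\<^sup>2))) = (\<lambda>x. exp (- s * of_real (x\<^sup>2)))"
      using t' by (simp add: power_divide scaleR_conv_of_real field_simps flip: of_real_power)
    finally show ?thesis using t' by simp
  qed
  have "((\<lambda>t. (1 / sqrt t) *\<^sub>R ?J) has_vector_derivative (- (1/2)) *\<^sub>R ?J) (at 1)"
    by (auto intro!: derivative_eq_intros simp: has_real_derivative_iff_has_vector_derivative[symmetric])
  then have "((\<lambda>t. \<integral>x. exp (- (0 + t *\<^sub>R s) * of_real ((x::real)\<^sup>2)) \<partial>lborel)
      has_vector_derivative (- (1/2)) *\<^sub>R ?J) (at 1)"
    by (rule has_vector_derivative_transform_within_open[where S="{0<..}"]) (use scale in auto)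
  from vector_derivative_unique_at[OF complex_gaussian_path_derivative this] s
  show ?thesis by (simp add: scaleR_conv_of_real)
qed

text \<open>On the segment from 1 to \<open>s\<close>, which stays in the right half-plane, the
  second moment formula says J' = - J / (2 \<gamma>) \<gamma>'. Hence J times
  \<open>csqrt \<gamma>\<close> is constant, and its value at 1 is the real Gaussian integral.
  Continuity of \<open>csqrt\<close> along the segment selects the correct root.\<close>

lemma complex_gaussian_integral_real:
  assumes s: "Re s > 0"
  shows "(\<integral>x. exp (- s * of_real ((x::real)\<^sup>2)) \<partial>lborel) * csqrt s = of_real (sqrt pi)"
proof -
  define \<gamma> where "\<gamma> \<theta> = 1 + \<theta> *\<^sub>R (s - 1)" for \<theta> :: real
  let ?J = "\<lambda>\<theta>. \<integral>x. exp (- \<gamma> \<theta> * of_real ((x::real)\<^sup>2)) \<partial>lborel"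
  have Re_\<gamma>: "Re (\<gamma> \<theta>) > 0" if "\<theta> \<in> {0..1}" for \<theta>
  proof -
    have "Re (\<gamma> \<theta>) = (1 - \<theta>) * 1 + \<theta> * Re s" by (simp add: \<gamma>_def algebra_simps)
    then show ?thesis
      using that s by (cases "\<theta> = 0") (auto intro: add_nonneg_pos)
  qed
  have "((\<lambda>\<theta>. ?J \<theta> * csqrt (\<gamma> \<theta>)) has_vector_derivative 0) (at \<theta> within {0..1})"
    if \<theta>: "\<theta> \<in> {0..1}" for \<theta>
  proof (rule has_vector_derivative_at_within)
    let ?I = "\<integral>x. - \<gamma> \<theta> * of_real ((x::real)\<^sup>2) * exp (- \<gamma> \<theta> * of_real (x\<^sup>2)) \<partial>lborel"
    have nz: "\<gamma> \<theta> \<noteq> 0" using Re_\<gamma>[OF \<theta>] by auto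
    have "(?J has_vector_derivative (\<integral>x. - (s - 1) * of_real ((x::real)\<^sup>2) * exp (- \<gamma> \<theta> * of_real (x\<^sup>2)) \<partial>lborel)) (at \<theta>)"
      using complex_gaussian_path_derivative[of 1 \<theta> "s - 1"] Re_\<gamma>[OF \<theta>] unfolding \<gamma>_def by blast
    also have "(\<lambda>x. - (s - 1) * of_real ((x::real)\<^sup>2) * exp (- \<gamma> \<theta> * of_real (x\<^sup>2))) =
        (\<lambda>x. ((s - 1) / \<gamma> \<theta>) * (- \<gamma> \<theta> * of_real (x\<^sup>2) * exp (- \<gamma> \<theta> * of_real (x\<^sup>2))))"
      using nz by (auto simp: fun_eq_iff field_simps)
    also have "(\<integral>x. ((s - 1) / \<gamma> \<theta>) * (- \<gamma> \<theta> * of_real ((x::real)\<^sup>2) * exp (- \<gamma> \<theta> * of_real (x\<^sup>2))) \<partial>lborel)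
        = ((s - 1) / \<gamma> \<theta>) * ?I"
      by (rule integral_mult_right_zero)
    also have "?I = - (1/2) * ?J \<theta>"
      by (rule gaussian_second_moment) (rule Re_\<gamma>[OF \<theta>])
    finally have J': "(?J has_vector_derivative ((s - 1) / \<gamma> \<theta>) * (- (1/2) * ?J \<theta>)) (at \<theta>)" .
    have \<gamma>': "(\<gamma> has_vector_derivative (s - 1)) (at \<theta>)"
      unfolding \<gamma>_def by (auto intro!: derivative_eq_intros)
    have "(csqrt has_field_derivative inverse (2 * csqrt (\<gamma> \<theta>))) (at (\<gamma> \<theta>))"
      using Re_\<gamma>[OF \<theta>] by (intro has_field_derivative_csqrt) (auto simp: complex_nonpos_Reals_iff)
    from field_vector_diff_chain_at[OF \<gamma>' this]
    have "((\<lambda>\<theta>. csqrt (\<gamma> \<theta>)) has_vector_derivative (s - 1) * (inverse (2 * csqrt (\<gamma> \<theta>)))) (at \<theta>)"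
      by (simp add: o_def)
    from has_vector_derivative_mult[OF J' this]
    have "((\<lambda>\<theta>. ?J \<theta> * csqrt (\<gamma> \<theta>)) has_vector_derivative
      ?J \<theta> * ((s - 1) * (inverse (2 * csqrt (\<gamma> \<theta>)))) + ((s - 1) / \<gamma> \<theta>) * (- (1/2) * ?J \<theta>) * csqrt (\<gamma> \<theta>)) (at \<theta>)" .
    also have "?J \<theta> * ((s - 1) * (inverse (2 * csqrt (\<gamma> \<theta>)))) + ((s - 1) / \<gamma> \<theta>) * (- (1/2) * ?J \<theta>) * csqrt (\<gamma> \<theta>) = 0"
    proof -
      define q where "q = csqrt (\<gamma> \<theta>)"
      have "\<gamma> \<theta> = q\<^sup>2" "q \<noteq> 0" using nz by (simp_all add: q_def)
      then show ?thesis unfolding q_def[symmetric]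
        by (simp add: field_simps power2_eq_square)
    qed
    finally show "((\<lambda>\<theta>. ?J \<theta> * csqrt (\<gamma> \<theta>)) has_vector_derivative 0) (at \<theta>)" .
  qed
  from has_vector_derivative_zero_constant[OF convex_real_interval(5) this]
  obtain c where c: "\<And>\<theta>. \<theta> \<in> {0..1} \<Longrightarrow> ?J \<theta> * csqrt (\<gamma> \<theta>) = c" by blast
  have "?J 0 * csqrt (\<gamma> 0) = ?J 1 * csqrt (\<gamma> 1)"
    using c[of 0] c[of 1] by simp
  then have "?J 1 * csqrt (\<gamma> 1) = ?J 0" by (simp add: \<gamma>_def)
  also have "?J 0 = (\<integral>x. of_real (exp (- (x::real)\<^sup>2)) \<partial>lborel)"
    by (intro Bochner_Integration.integral_cong refl) (simp add: \<gamma>_def flip: exp_of_real)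
  also have "\<dots> = of_real (\<integral>x. exp (- (x::real)\<^sup>2) \<partial>lborel)"
    using integrable_gaussian_even_moment[of 1 0] by (intro integral_of_real) simp
  also have "(\<integral>x. exp (- (x::real)\<^sup>2) \<partial>lborel) = sqrt pi"
    using has_bochner_integral_even_function[OF gaussian_moment_0] by (simp add: has_bochner_integral_iff)
  finally show ?thesis by (simp add: \<gamma>_def)
qed

lemma norm_power2_eq_sum_Basis: "(norm (x::'a::euclidean_space))\<^sup>2 = (\<Sum>b\<in>Basis. (x \<bullet> b)\<^sup>2)"
  by (subst power2_norm_eq_inner, subst euclidean_inner) (simp add: power2_eq_square)

lemma
  assumes s: "Re s > 0"
  shows integrable_complex_gaussian_euclidean:
      "integrable lborel (\<lambda>x::'a::euclidean_space. exp (- s * of_real ((norm x)\<^sup>2)))" (is ?int)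
    and complex_gaussian_integral_euclidean:
      "(\<integral>x. exp (- s * of_real ((norm (x::'a))\<^sup>2)) \<partial>lborel) = (of_real (sqrt pi) / csqrt s) ^ DIM('a)" (is ?eq)
proof -
  have eq: "exp (- s * of_real ((norm x)\<^sup>2)) = (\<Prod>b\<in>Basis. exp (- s * of_real ((x \<bullet> b)\<^sup>2)))" for x :: 'a
    by (simp add: norm_power2_eq_sum_Basis exp_sum[symmetric] sum_distrib_left sum_negf)
  have "s \<noteq> 0" using s by auto
  then have J: "(\<integral>x. exp (- s * of_real ((x::real)\<^sup>2)) \<partial>lborel) = of_real (sqrt pi) / csqrt s"
    using complex_gaussian_integral_real[OF s] by (simp add: field_simps)
  show ?int
    unfolding eq by (rule integrable_lborel_prod_Basis) (rule integrable_complex_gaussian[OF s])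
  show ?eq
    unfolding eq by (subst integral_lborel_prod_Basis) (auto intro: integrable_complex_gaussian[OF s] simp only: J prod_constant)
qed

section \<open>The heat kernel at complex time\<close>

lemma bounded_continuous_compact_support:
  fixes f :: "'a::euclidean_space \<Rightarrow> 'b::real_normed_vector"
  assumes "continuous_on UNIV f" and "\<And>x. norm x > R \<Longrightarrow> f x = 0"
  obtains B where "B \<ge> 0" and "\<And>x. norm (f x) \<le> B"
proof -
  have "bounded (f ` cball 0 R)"
    using assms by (intro compact_imp_bounded compact_continuous_image) (auto intro: continuous_on_subset)
  then obtain B where "B > 0" "\<And>x. norm x \<le> R \<Longrightarrow> norm (f x) \<le> B"
    by (auto simp: bounded_pos)
  with assms(2) that[of B] show thesis
    by (metis less_eq_real_def norm_zero not_less)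
qed

lemma integrable_continuous_compact_support:
  fixes f :: "'a::euclidean_space \<Rightarrow> 'b::{banach,second_countable_topology}"
  assumes "continuous_on UNIV f" and "\<And>x. norm x > R \<Longrightarrow> f x = 0"
  shows "integrable lborel f"
proof -
  have "integrable lborel (\<lambda>x. indicator (cball 0 R) x *\<^sub>R f x)"
    using assms(1) by (intro borel_integrable_compact) (auto intro: continuous_on_subset)
  also have "(\<lambda>x. indicator (cball 0 R) x *\<^sub>R f x) = f"
    using assms(2) by (auto simp: fun_eq_iff indicator_def not_le)
  finally show ?thesis .
qed

lemma integrable_indicator_cball: "integrable lborel (\<lambda>x. B * indicator (cball (0::'a::euclidean_space) R) x :: real)"
  by (intro integrable_mult_right integrable_real_indicator emeasure_bounded_finite) simp_all

text \<open>Directional derivatives are computed at parameter 0 for every base point; moving the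
  base point gives them at every parameter.\<close>

lemma has_vector_derivative_along_line:
  fixes x e :: "'a::real_vector"
  assumes "((\<lambda>h. f (x + t *\<^sub>R e + h *\<^sub>R e)) has_vector_derivative D) (at 0)"
  shows "((\<lambda>t. f (x + t *\<^sub>R e)) has_vector_derivative D) (at t)"
proof -
  have eq: "x + (t + h) *\<^sub>R e = x + t *\<^sub>R e + h *\<^sub>R e" for h
    by (simp add: scaleR_left_distrib add.assoc)
  from assms show ?thesis
    by (simp only: has_vector_derivative_at_iff_quotient eq scaleR_zero_left add_0_right add_0_left)
qed

text \<open>The integral of a translate is constant in the translation; differentiate under the integral.\<close>
lemma integral_directional_derivative_eq_0:
  fixes f :: "'a::euclidean_space \<Rightarrow> 'b::{banach,second_countable_topology}"
  assumes der: "\<And>x. ((\<lambda>t. f (x + t *\<^sub>R e)) has_vector_derivative f' x) (at 0)"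
    and cont: "continuous_on UNIV f" "continuous_on UNIV f'"
    and supp: "\<And>x. norm x > R \<Longrightarrow> f x = 0" "\<And>x. norm x > R \<Longrightarrow> f' x = 0"
  shows "(\<integral>x. f' x \<partial>lborel) = 0"
proof -
  obtain B where B: "B \<ge> 0" "\<And>x. norm (f' x) \<le> B"
    using bounded_continuous_compact_support[OF cont(2) supp(2)] by metis
  have "((\<lambda>t. \<integral>x. f (x + t *\<^sub>R e) \<partial>lborel) has_vector_derivative (\<integral>x. f' (x + 0 *\<^sub>R e) \<partial>lborel)) (at 0)"
  \<comment> \<open>For \<open>\<bar>t\<bar> < 1\<close> the translated support stays within radius
    \<open>R + norm e\<close>.\<close>
  proof (rule has_vector_derivative_integral[where \<delta>=1 and f'="\<lambda>t x. f' (x + t *\<^sub>R e)"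
        and g="\<lambda>x. B * indicator (cball 0 (R + norm e)) x"])
    fix t :: real and x assume "t \<in> ball 0 1"
    then have t: "\<bar>t\<bar> < 1" by simp
    show "integrable lborel (\<lambda>x. f (x + t *\<^sub>R e))"
      using integrable_lborel_affine_iff[of 1 f "t *\<^sub>R e"] integrable_continuous_compact_support[OF cont(1) supp(1)]
      by (simp add: add.commute)
    show "((\<lambda>t. f (x + t *\<^sub>R e)) has_vector_derivative f' (x + t *\<^sub>R e)) (at t)"
      by (rule has_vector_derivative_along_line) (rule der)
    show "norm (f' (x + t *\<^sub>R e)) \<le> B * indicator (cball 0 (R + norm e)) x"
    proof (cases "norm x \<le> R + norm e")
      case False
      have "norm (t *\<^sub>R e) \<le> norm e" using t by (simp add: mult_left_le_one_le)
      then have "norm (x + t *\<^sub>R e) > R"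
        using False norm_triangle_ineq2[of x "- (t *\<^sub>R e)"] by simp
      then show ?thesis using supp(2) B by simp
    qed (use B in simp)
  qed (use integrable_indicator_cball in auto)
  moreover have "(\<integral>x. f (x + t *\<^sub>R e) \<partial>lborel) = (\<integral>x. f x \<partial>lborel)" for t
    using integral_lborel_affine[of 1 f "t *\<^sub>R e"] by (simp add: add.commute)
  ultimately have "((\<lambda>t. \<integral>x. f x \<partial>lborel) has_vector_derivative (\<integral>x. f' x \<partial>lborel)) (at (0::real))"
    by simp
  from vector_derivative_unique_at[OF this has_vector_derivative_const] show ?thesis .
qed

section \<open>The kernel and its heat equation\<close>

text \<open>
  With \<open>v = exp w\<close>, this is the heat kernel at the complex time \<open>v / s\<close>.
\<close>
definition heat :: "complex \<Rightarrow> real \<Rightarrow> 'a::euclidean_space \<Rightarrow> complex" where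
  "heat s w x = (csqrt s / of_real (2 * sqrt pi)) ^ DIM('a) *
     exp (- of_real (real DIM('a) * w / 2) - s * of_real (exp (- w) * (norm x)\<^sup>2 / 4))"

text \<open>The derivative in the logarithmic time \<open>w\<close>, that is t d/dt at t =
  \<open>exp w / s\<close>.\<close>

definition heat' :: "complex \<Rightarrow> real \<Rightarrow> 'a::euclidean_space \<Rightarrow> complex" where
  "heat' s w x = heat s w x * (s * of_real (exp (- w) * (norm x)\<^sup>2 / 4) - of_real (real DIM('a) / 2))"

lemma continuous_on_heat [continuous_intros]:
  "continuous_on A f \<Longrightarrow> continuous_on A g \<Longrightarrow> continuous_on A (\<lambda>x. heat s (f x) (g x))"
  unfolding heat_def by (intro continuous_intros) auto

lemma continuous_on_heat' [continuous_intros]: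
  "continuous_on A f \<Longrightarrow> continuous_on A g \<Longrightarrow> continuous_on A (\<lambda>x. heat' s (f x) (g x))"
  unfolding heat'_def by (intro continuous_intros) auto

lemma heat_has_vector_derivative:
  "((\<lambda>w. heat s w x) has_vector_derivative heat' s w (x::'a::euclidean_space)) (at w)"
proof -
  have "((\<lambda>w. heat s w x) has_vector_derivative
      (csqrt s / of_real (2 * sqrt pi)) ^ DIM('a) *
     (exp (- of_real (real DIM('a) * w / 2) - s * of_real (exp (- w) * (norm x)\<^sup>2 / 4))
       * (- of_real (real DIM('a) / 2) - s * (of_real (- exp (- w) * (norm x)\<^sup>2 / 4))))) (at w)"
    unfolding heat_def
  proof (intro has_vector_derivative_mult_right field_vector_diff_chain_at[unfolded o_def, of _ _ _ exp,
        THEN has_vector_derivative_eq_rhs])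
    show "((\<lambda>w. - complex_of_real (real DIM('a) * w / 2) - s * of_real (exp (- w) * (norm x)\<^sup>2 / 4))
        has_vector_derivative - of_real (real DIM('a) / 2) - s * (of_real (- exp (- w) * (norm x)\<^sup>2 / 4))) (at w)"
      by (intro has_vector_derivative_diff has_vector_derivative_minus has_vector_derivative_mult_right
          has_vector_derivative_of_real) (auto intro!: derivative_eq_intros)
  qed (auto intro: DERIV_exp simp: mult_ac)
  then show ?thesis
    by (simp add: heat'_def heat_def algebra_simps)
qed

text \<open>With the square expanded, the exponent is a polynomial in \<open>t\<close>, so that no
  norm has to be differentiated.\<close>

lemma heat_translate_Basis:
  assumes b: "b \<in> Basis"
  shows "heat s w (x + t *\<^sub>R b) = (csqrt s / of_real (2 * sqrt pi)) ^ DIM('a) *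
     exp (- of_real (real DIM('a) * w / 2) - s * of_real (exp (- w) / 4) *
       (of_real ((norm (x::'a::euclidean_space))\<^sup>2) + 2 * of_real (x \<bullet> b) * of_real t + (of_real t)\<^sup>2))"
proof -
  have "(norm (x + t *\<^sub>R b))\<^sup>2 = (norm x)\<^sup>2 + 2 * (x \<bullet> b) * t + t\<^sup>2"
    using b unfolding power2_norm_eq_inner by (simp add: algebra_simps inner_commute power2_eq_square)
  then show ?thesis unfolding heat_def by (simp add: mult.assoc)
qed

lemma heat_directional_derivative:
  assumes b: "b \<in> Basis"
  shows "((\<lambda>t. heat s w (x + t *\<^sub>R b)) has_vector_derivative
      heat s w x * (- s * of_real (exp (- w) * (x \<bullet> b) / 2))) (at 0)"
  unfolding heat_translate_Basis[OF b]
  by (rule has_vector_derivative_real_field[THEN has_vector_derivative_eq_rhs])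
     (auto intro!: derivative_eq_intros simp: heat_def algebra_simps)

lemma heat_directional_derivative2:
  assumes b: "b \<in> Basis"
  shows "((\<lambda>t. heat s w (x + t *\<^sub>R b) * (- s * of_real (exp (- w) * ((x + t *\<^sub>R b) \<bullet> b) / 2))) has_vector_derivative
      heat s w x * ((s * of_real (exp (- w) * (x \<bullet> b) / 2))\<^sup>2 - s * of_real (exp (- w) / 2))) (at 0)"
proof -
  have "((\<lambda>t. - s * of_real (exp (- w) * ((x + t *\<^sub>R b) \<bullet> b) / 2)) has_vector_derivative
      - s * of_real (exp (- w) / 2)) (at 0)"
    using b by (auto intro!: has_vector_derivative_mult_right has_vector_derivative_of_real derivative_eq_intros
        simp: inner_add_left)
  from has_vector_derivative_mult[OF heat_directional_derivative[OF b] this]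
  show ?thesis
    by (rule has_vector_derivative_eq_rhs) (simp add: algebra_simps power2_eq_square)
qed

text \<open>The left side is the Laplacian of \<open>heat s w\<close>, by
  \<open>heat_directional_derivative2\<close>. As \<open>heat'\<close> is t d/dt, the heat equation
  acquires the factor 1/t = \<open>s * exp (- w)\<close>.\<close>

lemma heat_equation:
  fixes x :: "'a::euclidean_space"
  shows "(\<Sum>b\<in>Basis. heat s w x * ((s * of_real (exp (- w) * (x \<bullet> b) / 2))\<^sup>2 - s * of_real (exp (- w) / 2)))
    = s * of_real (exp (- w)) * heat' s w x"
proof -
  have "(\<Sum>b\<in>Basis. (s * of_real (exp (- w) * (x \<bullet> b) / 2))\<^sup>2) = s\<^sup>2 * of_real ((exp (- w))\<^sup>2 * (norm x)\<^sup>2 / 4)"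
    by (simp add: norm_power2_eq_sum_Basis power_mult_distrib power_divide sum_distrib_left sum_divide_distrib mult.assoc)
  moreover have "(\<Sum>b\<in>Basis. heat s w x * ((s * of_real (exp (- w) * (x \<bullet> b) / 2))\<^sup>2 - s * of_real (exp (- w) / 2)))
    = heat s w x * ((\<Sum>b\<in>Basis. (s * of_real (exp (- w) * (x \<bullet> b) / 2))\<^sup>2)
        - of_nat DIM('a) * (s * of_real (exp (- w) / 2)))"
    by (simp only: sum_distrib_left[symmetric] sum_subtractf sum_constant mult.left_commute)
  ultimately show ?thesis
    by (simp add: heat'_def algebra_simps power2_eq_square)
qed

section \<open>Rescaling to a fixed Gaussian profile\<close>

text \<open>The heat kernel at complex time 1 / (4 s), the common profile of all
  \<open>heat s w\<close>.\<close>

definition gauss :: "complex \<Rightarrow> 'a::euclidean_space \<Rightarrow> complex" where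
  "gauss s x = (csqrt s / of_real (sqrt pi)) ^ DIM('a) * exp (- s * of_real ((norm x)\<^sup>2))"

lemma integrable_gauss: "Re s > 0 \<Longrightarrow> integrable lborel (gauss s)"
  unfolding gauss_def by (intro integrable_mult_right integrable_complex_gaussian_euclidean)

lemma integral_gauss:
  assumes s: "Re s > 0"
  shows "(\<integral>x. gauss s (x::'a::euclidean_space) \<partial>lborel) = 1"
proof -
  have "csqrt s \<noteq> 0" using s by auto
  moreover have "(\<integral>x. gauss s (x::'a) \<partial>lborel) =
      (csqrt s / of_real (sqrt pi)) ^ DIM('a) * (of_real (sqrt pi) / csqrt s) ^ DIM('a)"
    unfolding gauss_def integral_mult_right_zero complex_gaussian_integral_euclidean[OF s] ..
  ultimately show ?thesis
    by (simp flip: power_mult_distrib)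
qed

lemma heat_rescale:
  fixes x :: "'a::euclidean_space"
  shows "of_real ((2 * exp (w / 2)) ^ DIM('a)) * heat s w ((2 * exp (w / 2)) *\<^sub>R x) = gauss s x"
proof -
  have 1: "exp (- w) * (norm ((2 * exp (w / 2)) *\<^sub>R x))\<^sup>2 / 4 = (norm x)\<^sup>2"
    by (simp add: power_mult_distrib exp_minus field_simps flip: exp_double)
  have 2: "exp (- complex_of_real (real DIM('a) * w / 2)) = 1 / of_real (exp (w / 2)) ^ DIM('a)"
    by (simp add: exp_minus exp_of_nat_mult[symmetric] inverse_eq_divide flip: exp_of_real)
  show ?thesis
    unfolding heat_def gauss_def 1 exp_diff 2
    by (simp add: power_mult_distrib power_divide exp_minus field_simps)
qed

text \<open>The substitution moves all dependence on \<open>w\<close> from the kernel into the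
  argument of \<open>f\<close>. So the L1 norm of the kernel is the same for every \<open>w\<close>,
  and the limit of small times becomes a limit inside \<open>f\<close>.\<close>

lemma
  fixes f :: "'a::euclidean_space \<Rightarrow> complex"
  shows integral_heat_rescale: "(\<integral>x. heat s w (x - a) * f x \<partial>lborel) =
      (\<integral>x. gauss s x * f (a + (2 * exp (w / 2)) *\<^sub>R x) \<partial>lborel)"
    and integral_norm_heat: "(\<integral>x. norm (heat s w (x - a)) \<partial>lborel) = (\<integral>x. norm (gauss s (x::'a)) \<partial>lborel)"
    and integrable_heat: "Re s > 0 \<Longrightarrow> integrable lborel (\<lambda>x. heat s w (x - a))"
proof -
  define c where "c = 2 * exp (w / 2)"
  have c: "c > 0" by (simp add: c_def)
  have heat: "heat s w (a + c *\<^sub>R x - a) = of_real (1 / c ^ DIM('a)) * gauss s x" for x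
    using heat_rescale[of w s x] c unfolding c_def[symmetric] by (simp add: field_simps)
  show "(\<integral>x. heat s w (x - a) * f x \<partial>lborel) = (\<integral>x. gauss s x * f (a + c *\<^sub>R x) \<partial>lborel)"
    unfolding integral_lborel_affine[of c "\<lambda>x. heat s w (x - a) * f x" a, OF c[THEN less_imp_neq, symmetric]] heat
    using c by (simp add: scaleR_conv_of_real mult.assoc)
  show "(\<integral>x. norm (heat s w (x - a)) \<partial>lborel) = (\<integral>x. norm (gauss s (x::'a)) \<partial>lborel)"
    unfolding integral_lborel_affine[of c "\<lambda>x. norm (heat s w (x - a))" a, OF c[THEN less_imp_neq, symmetric]] heat
      norm_mult integral_mult_right_zero
    using c by (simp add: norm_divide norm_power)
  show "integrable lborel (\<lambda>x. heat s w (x - a))" if "Re s > 0"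
    unfolding integrable_lborel_affine_iff[of c "\<lambda>x. heat s w (x - a)" a, OF c[THEN less_imp_neq, symmetric], symmetric] heat
    by (intro integrable_mult_right integrable_gauss that)
qed

section \<open>The Green function as an integral over complex time\<close>

text \<open>For t = \<open>exp w / s\<close>, the first factor is dt/dw and the exponential is exp
  (- s^2 t).\<close>

definition green_kernel :: "complex \<Rightarrow> real \<Rightarrow> 'a::euclidean_space \<Rightarrow> complex" where
  "green_kernel s w x = of_real (exp w) / s * exp (- s * of_real (exp w)) * heat s w x"

definition green :: "complex \<Rightarrow> 'a::euclidean_space \<Rightarrow> complex" where
  "green s x = (\<integral>w. green_kernel s w x \<partial>lborel)"

lemma measurable_green_kernel [measurable]:
  fixes g :: "'b \<Rightarrow> 'a::euclidean_space"
  assumes [measurable]: "f \<in> borel_measurable M" "g \<in> borel_measurable M"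
  shows "(\<lambda>x. green_kernel s (f x) (g x)) \<in> borel_measurable M"
  unfolding green_kernel_def heat_def by measurable

lemma measurable_green [measurable]: "green s \<in> borel_measurable (borel :: 'a::euclidean_space measure)"
  unfolding green_def by (rule lborel.borel_measurable_lebesgue_integral) measurable

lemma integrable_exp_exp:
  assumes \<sigma>: "\<sigma> > (0::real)"
  shows "integrable lborel (\<lambda>w. exp w * exp (- \<sigma> * exp w))"
proof -
  have "set_integrable lborel (einterval (-\<infinity>) \<infinity>) (\<lambda>w. exp w * exp (- \<sigma> * exp w))"
  proof (rule interval_integral_FTC_nonneg)
    show "((\<lambda>w. - (1 / \<sigma>) * exp (- \<sigma> * exp w)) has_real_derivative exp w * exp (- \<sigma> * exp w)) (at w)" for w
      using \<sigma> by (auto intro!: derivative_eq_intros)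
    have "((\<lambda>w. - (1 / \<sigma>) * exp (- \<sigma> * exp w)) \<longlongrightarrow> - (1 / \<sigma>) * exp (- \<sigma> * 0)) at_bot"
      by (intro tendsto_intros exp_at_bot)
    then show "(((\<lambda>w. - (1 / \<sigma>) * exp (- \<sigma> * exp w)) \<circ> real_of_ereal) \<longlongrightarrow> - (1 / \<sigma>)) (at_right (- \<infinity>))"
      by (simp add: ereal_tendsto_simps)
    have "filterlim (\<lambda>w::real. - \<sigma> * exp w) at_bot at_top"
      using \<sigma> exp_at_top by (intro filterlim_tendsto_neg_mult_at_bot[OF tendsto_const]) auto
    then have "((\<lambda>w. - (1 / \<sigma>) * exp (- \<sigma> * exp w)) \<longlongrightarrow> - (1 / \<sigma>) * 0) at_top"
      by (intro tendsto_intros filterlim_compose[OF exp_at_bot])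
    then show "(((\<lambda>w. - (1 / \<sigma>) * exp (- \<sigma> * exp w)) \<circ> real_of_ereal) \<longlongrightarrow> 0) (at_left \<infinity>)"
      by (simp add: ereal_tendsto_simps)
  qed auto
  then show ?thesis by (simp add: set_integrable_def einterval_def)
qed

text \<open>Integrating the modulus over \<open>x\<close> first leaves a constant times
  \<open>exp w * exp (- Re s * exp w)\<close>, because the L1 norm of \<open>heat s w\<close> does
  not depend on \<open>w\<close>. This covers the singularity at \<open>a\<close> without an
  estimate of it.\<close>

lemma integrable_green_kernel_pair:
  assumes s: "Re s > 0"
  shows "integrable (lborel \<Otimes>\<^sub>M lborel) (\<lambda>(w, x). green_kernel s w (x - a :: 'a::euclidean_space))"
proof (rule lborel_pair.Fubini_integrable)
  show "(\<lambda>(w, x). green_kernel s w (x - a)) \<in> borel_measurable (lborel \<Otimes>\<^sub>M lborel)"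
    by measurable
  have "(\<integral>x. norm (green_kernel s w (x - a)) \<partial>lborel)
      = ((\<integral>x. norm (gauss s (x::'a)) \<partial>lborel) / norm s) * (exp w * exp (- Re s * exp w))" for w
    unfolding green_kernel_def norm_mult norm_exp_minus_mult_of_real integral_mult_right_zero integral_norm_heat
    by (simp add: norm_divide)
  then show "integrable lborel (\<lambda>w. \<integral>x. norm (case (w, x) of (w, x) \<Rightarrow> green_kernel s w (x - a)) \<partial>lborel)"
    using integrable_exp_exp[OF s] by simp
  show "AE w in lborel. integrable lborel (\<lambda>x. case (w, x) of (w, x) \<Rightarrow> green_kernel s w (x - a))"
    unfolding green_kernel_def by (simp add: integrable_heat[OF s])
qed

lemma integrable_green:
  assumes s: "Re s > 0"
  shows "integrable lborel (\<lambda>x. green s (x - a :: 'a::euclidean_space))"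
proof -
  have "integrable (lborel \<Otimes>\<^sub>M lborel) (\<lambda>(x, w). green_kernel s w (x - a))"
    using lborel_pair.integrable_product_swap[OF integrable_green_kernel_pair[OF s]] by simp
  from lborel_pair.integrable_fst'[OF this] show ?thesis
    by (simp add: green_def)
qed

section \<open>The heat kernel paired with a function\<close>

context
  fixes s :: complex and a :: "'a::euclidean_space"
  assumes s: "Re s > 0"
begin

lemma integrable_heat_mult:
  assumes "continuous_on UNIV f" "\<And>x. norm x > R \<Longrightarrow> f x = 0"
  shows "integrable lborel (\<lambda>x. heat s w (x - a) * f x)"
  by (rule integrable_continuous_compact_support[where R=R])
     (use assms in \<open>auto intro!: continuous_intros\<close>)

lemma integral_heat_mult_has_derivative:
  assumes cont: "continuous_on UNIV f" and supp: "\<And>x. norm x > R \<Longrightarrow> f x = 0"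
  shows "((\<lambda>w. \<integral>x. heat s w (x - a) * f x \<partial>lborel) has_vector_derivative
      (\<integral>x. heat' s w (x - a) * f x \<partial>lborel)) (at w)"
proof -
  have "compact (cball w 1 \<times> cball (0::'a) R)"
    by (intro compact_Times) auto
  then have "compact ((\<lambda>(t, x). heat' s t (x - a) * f x) ` (cball w 1 \<times> cball 0 R))"
    using cont unfolding case_prod_beta
    by (intro compact_continuous_image continuous_intros continuous_on_compose2[OF cont]) auto
  then obtain B where B: "B > 0"
    "\<And>t x. t \<in> cball w 1 \<Longrightarrow> norm x \<le> R \<Longrightarrow> norm (heat' s t (x - a) * f x) \<le> B"
    by (force dest!: compact_imp_bounded simp: bounded_pos)
  show ?thesis
  proof (rule has_vector_derivative_integral[where \<delta>=1 and g="\<lambda>x. B * indicator (cball 0 R) x"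
        and f'="\<lambda>w x. heat' s w (x - a) * f x"])
    show "((\<lambda>w. heat s w (x - a) * f x) has_vector_derivative heat' s t (x - a) * f x) (at t)" for t x
      by (intro has_vector_derivative_mult_left heat_has_vector_derivative)
    show "norm (heat' s t (x - a) * f x) \<le> B * indicator (cball 0 R) x" if "t \<in> ball w 1" for t x
      using B that supp[of x] by (cases "norm x \<le> R") auto
  qed (use integrable_heat_mult[OF cont supp] integrable_indicator_cball in auto)
qed

lemma integral_heat_continuous:
  assumes "continuous_on UNIV f" "\<And>x. norm x > R \<Longrightarrow> f x = 0"
  shows "isCont (\<lambda>w. \<integral>x. heat s w (x - a) * f x \<partial>lborel) w"
  by (rule has_vector_derivative_continuous) (rule integral_heat_mult_has_derivative[OF assms])

text \<open>The bound is uniform in \<open>w\<close>. It controls the end where \<open>w\<close>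
  tends to infinity, in combination with the decay of \<open>exp (- s * exp w)\<close>.\<close>

lemma integral_heat_bound:
  assumes cont: "continuous_on UNIV f" and bound: "\<And>x. norm (f x) \<le> B"
  shows "norm (\<integral>x. heat s w (x - a) * f x \<partial>lborel) \<le> B * (\<integral>x. norm (gauss s (x::'a)) \<partial>lborel)"
proof -
  have [measurable]: "f \<in> borel_measurable borel"
    using cont by (rule borel_measurable_continuous_onI)
  have "norm (\<integral>x. heat s w (x - a) * f x \<partial>lborel) \<le> (\<integral>x. B * norm (heat s w (x - a)) \<partial>lborel)"
  proof (rule order_trans[OF integral_norm_bound], rule integral_mono)
    show I: "integrable lborel (\<lambda>x. B * norm (heat s w (x - a)))"
      by (intro integrable_mult_right integrable_norm integrable_heat s)
    show "norm (heat s w (x - a) * f x) \<le> B * norm (heat s w (x - a))" for x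
      using bound[of x] by (simp add: norm_mult mult.commute mult_right_mono)
    with I show "integrable lborel (\<lambda>x. norm (heat s w (x - a) * f x))"
      by (rule_tac Bochner_Integration.integrable_bound[OF I])
         (auto simp: heat_def intro: order_trans[OF _ abs_ge_self])
  qed
  then show ?thesis
    by (simp add: integral_norm_heat)
qed

text \<open>The complex Gaussian is still an approximate identity: positivity is replaced by
  integrability together with total integral 1, and after rescaling the limit is dominated
  convergence.\<close>

lemma integral_heat_tendsto:
  assumes cont: "continuous_on UNIV f" and bound: "\<And>x. norm (f x) \<le> B"
  shows "((\<lambda>w. \<integral>x. heat s w (x - a) * f x \<partial>lborel) \<longlongrightarrow> f a) at_bot"
proof -
  have [measurable]: "f \<in> borel_measurable borel"
    using cont by (rule borel_measurable_continuous_onI)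
  \<comment> \<open>The sign of \<open>w\<close> is reversed so that the limit is taken at
    \<open>at_top\<close>.\<close>
  have lim: "((\<lambda>w. 2 * exp (- w / 2) :: real) \<longlongrightarrow> 0) at_top"
  proof -
    have "filterlim (\<lambda>w::real. - w / 2) at_bot at_top"
      using filterlim_tendsto_neg_mult_at_bot[OF tendsto_const[of "- (1/2)"] _ filterlim_ident] by simp
    from tendsto_mult_right_zero[OF filterlim_compose[OF exp_at_bot this]] show ?thesis .
  qed
  have "((\<lambda>w. \<integral>x. gauss s x * f (a + (2 * exp (- w / 2)) *\<^sub>R x) \<partial>lborel) \<longlongrightarrow> (\<integral>x. gauss s (x::'a) * f a \<partial>lborel)) at_top"
  proof (rule integral_dominated_convergence_at_top[where w="\<lambda>x. norm (gauss s x) * B"])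
    show "(\<lambda>x::'a. gauss s x * f a) \<in> borel_measurable lborel"
      "\<And>t. (\<lambda>x. gauss s x * f (a + (2 * exp (- t / 2)) *\<^sub>R x)) \<in> borel_measurable lborel"
      unfolding gauss_def by measurable
    show "integrable lborel (\<lambda>x::'a. norm (gauss s x) * B)"
      by (intro integrable_mult_left integrable_norm integrable_gauss s)
    show "AE x in lborel. ((\<lambda>w. gauss s x * f (a + (2 * exp (- w / 2)) *\<^sub>R x)) \<longlongrightarrow> gauss s x * f a) at_top"
    proof (intro AE_I2 tendsto_mult tendsto_const)
      fix x :: 'a
      have "((\<lambda>w. a + (2 * exp (- w / 2)) *\<^sub>R x) \<longlongrightarrow> a + 0 *\<^sub>R x) at_top"
        by (intro tendsto_intros lim)
      then show "((\<lambda>w. f (a + (2 * exp (- w / 2)) *\<^sub>R x)) \<longlongrightarrow> f a) at_top"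
        using cont by (intro isCont_tendsto_compose[of a f]) (auto simp: continuous_on_eq_continuous_at)
    qed
    show "\<forall>\<^sub>F w in at_top. AE x in lborel. norm (gauss s x * f (a + (2 * exp (- w / 2)) *\<^sub>R x)) \<le> norm (gauss s x) * B"
      using bound by (intro always_eventually allI AE_I2) (auto simp: norm_mult intro: mult_left_mono)
  qed
  also have "(\<integral>x. gauss s (x::'a) * f a \<partial>lborel) = f a"
    by (simp add: integral_gauss[OF s])
  finally show ?thesis
    unfolding filterlim_at_bot_mirror integral_heat_rescale .
qed

text \<open>Green's second identity, one coordinate at a time:
  \<open>?h2 b * \<phi> - ?h * \<phi>'' b\<close> is the derivative along \<open>b\<close> of
  \<open>?h1 b * \<phi> - ?h * \<phi>' b\<close>, which has compact support, so its integral is 0.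
  Summation over \<open>b\<close> and \<open>heat_equation\<close> then give
  \<open>heat'\<close>.\<close>

lemma integral_heat'_eq:
  fixes \<phi> :: "'a \<Rightarrow> complex"
  assumes der: "\<And>b x. b \<in> Basis \<Longrightarrow> ((\<lambda>t. \<phi> (x + t *\<^sub>R b)) has_vector_derivative \<phi>' b x) (at 0)"
      "\<And>b x. b \<in> Basis \<Longrightarrow> ((\<lambda>t. \<phi>' b (x + t *\<^sub>R b)) has_vector_derivative \<phi>'' b x) (at 0)"
    and cont: "continuous_on UNIV \<phi>" "\<And>b. b \<in> Basis \<Longrightarrow> continuous_on UNIV (\<phi>' b)"
      "\<And>b. b \<in> Basis \<Longrightarrow> continuous_on UNIV (\<phi>'' b)"
    and supp: "\<And>x. norm x > R \<Longrightarrow> \<phi> x = 0" "\<And>b x. b \<in> Basis \<Longrightarrow> norm x > R \<Longrightarrow> \<phi>' b x = 0"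
      "\<And>b x. b \<in> Basis \<Longrightarrow> norm x > R \<Longrightarrow> \<phi>'' b x = 0"
  shows "s * of_real (exp (- w)) * (\<integral>x. heat' s w (x - a) * \<phi> x \<partial>lborel) =
    (\<integral>x. heat s w (x - a) * (\<Sum>b\<in>Basis. \<phi>'' b x) \<partial>lborel)"
proof -
  let ?h = "\<lambda>x. heat s w (x - a)"
  let ?h1 = "\<lambda>b x. heat s w (x - a) * (- s * of_real (exp (- w) * ((x - a) \<bullet> b) / 2))"
  let ?h2 = "\<lambda>b x. heat s w (x - a) * ((s * of_real (exp (- w) * ((x - a) \<bullet> b) / 2))\<^sup>2 - s * of_real (exp (- w) / 2))"
  have int: "integrable lborel (\<lambda>x. ?h2 b x * \<phi> x)" "integrable lborel (\<lambda>x. ?h x * \<phi>'' b x)" if "b \<in> Basis" for b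
    by (rule integrable_continuous_compact_support[where R=R];
        use cont(1) cont(3)[OF that] supp(1) supp(3)[OF that] in \<open>auto intro!: continuous_intros\<close>)+
  have eq: "(\<integral>x. ?h2 b x * \<phi> x \<partial>lborel) = (\<integral>x. ?h x * \<phi>'' b x \<partial>lborel)" if b: "b \<in> Basis" for b
  proof -
    have "(\<integral>x. ?h2 b x * \<phi> x - ?h x * \<phi>'' b x \<partial>lborel) = 0"
    proof (rule integral_directional_derivative_eq_0[where f="\<lambda>x. ?h1 b x * \<phi> x - ?h x * \<phi>' b x" and e=b and R=R])
      fix x
      have h: "((\<lambda>t. ?h (x + t *\<^sub>R b)) has_vector_derivative ?h1 b x) (at 0)"
        using heat_directional_derivative[OF b, of s w "x - a"] by (simp add: algebra_simps)
      have h1: "((\<lambda>t. ?h1 b (x + t *\<^sub>R b)) has_vector_derivative ?h2 b x) (at 0)"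
        using heat_directional_derivative2[OF b, of s w "x - a"] by (simp only: diff_add_eq[symmetric])
      show "((\<lambda>t. ?h1 b (x + t *\<^sub>R b) * \<phi> (x + t *\<^sub>R b) - ?h (x + t *\<^sub>R b) * \<phi>' b (x + t *\<^sub>R b))
          has_vector_derivative ?h2 b x * \<phi> x - ?h x * \<phi>'' b x) (at 0)"
        by (rule has_vector_derivative_eq_rhs[OF has_vector_derivative_diff[OF
              has_vector_derivative_mult[OF h1 der(1)[OF b]] has_vector_derivative_mult[OF h der(2)[OF b]]]])
           (simp add: algebra_simps)
    qed (use cont(1) cont(2,3)[OF b] supp(1) supp(2,3)[OF b] in \<open>auto intro!: continuous_intros\<close>)
    with int[OF b] show ?thesis by simp
  qed
  have "(\<integral>x. ?h x * (\<Sum>b\<in>Basis. \<phi>'' b x) \<partial>lborel) = (\<Sum>b\<in>Basis. \<integral>x. ?h x * \<phi>'' b x \<partial>lborel)"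
    by (simp add: sum_distrib_left int)
  also have "\<dots> = (\<Sum>b\<in>Basis. \<integral>x. ?h2 b x * \<phi> x \<partial>lborel)"
    by (intro sum.cong refl) (simp only: eq)
  also have "\<dots> = (\<integral>x. (\<Sum>b\<in>Basis. ?h2 b x) * \<phi> x \<partial>lborel)"
    using int by (simp add: sum_distrib_right)
  also have "\<dots> = (\<integral>x. s * of_real (exp (- w)) * (heat' s w (x - a) * \<phi> x) \<partial>lborel)"
    by (simp only: heat_equation mult.assoc)
  also have "\<dots> = s * of_real (exp (- w)) * (\<integral>x. heat' s w (x - a) * \<phi> x \<partial>lborel)"
    by (rule integral_mult_right_zero)
  finally show ?thesis ..
qed

end

section \<open>The Green function of the full space\<close>

theorem green_fundamental_solution:
  fixes \<phi> :: "'a::euclidean_space \<Rightarrow> complex"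
  assumes s: "Re s > 0"
    and der: "\<And>b x. b \<in> Basis \<Longrightarrow> ((\<lambda>t. \<phi> (x + t *\<^sub>R b)) has_vector_derivative \<phi>' b x) (at 0)"
      "\<And>b x. b \<in> Basis \<Longrightarrow> ((\<lambda>t. \<phi>' b (x + t *\<^sub>R b)) has_vector_derivative \<phi>'' b x) (at 0)"
    and cont: "continuous_on UNIV \<phi>" "\<And>b. b \<in> Basis \<Longrightarrow> continuous_on UNIV (\<phi>' b)"
      "\<And>b. b \<in> Basis \<Longrightarrow> continuous_on UNIV (\<phi>'' b)"
    and supp: "\<And>x. norm x > R \<Longrightarrow> \<phi> x = 0" "\<And>b x. b \<in> Basis \<Longrightarrow> norm x > R \<Longrightarrow> \<phi>' b x = 0"
      "\<And>b x. b \<in> Basis \<Longrightarrow> norm x > R \<Longrightarrow> \<phi>'' b x = 0"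
  shows "(\<integral>x. green s (x - a) * (s\<^sup>2 * \<phi> x - (\<Sum>b\<in>Basis. \<phi>'' b x)) \<partial>lborel) = \<phi> a"
proof -
  define f where "f x = s\<^sup>2 * \<phi> x - (\<Sum>b\<in>Basis. \<phi>'' b x)" for x
  have f_cont: "continuous_on UNIV f"
    unfolding f_def using cont by (auto intro!: continuous_intros)
  have f_supp: "f x = 0" if "norm x > R" for x
    unfolding f_def using supp that by (simp add: sum.neutral)
  have [measurable]: "f \<in> borel_measurable borel"
    using f_cont by (rule borel_measurable_continuous_onI)
  obtain B where B: "B \<ge> 0" "\<And>x. norm (f x) \<le> B"
    using bounded_continuous_compact_support[OF f_cont f_supp] by metis
  obtain B\<phi> where B\<phi>: "\<And>x. norm (\<phi> x) \<le> B\<phi>"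
    using bounded_continuous_compact_support[OF cont(1) supp(1)] by metis
  \<comment> \<open>\<open>f\<close> is bounded, so joint integrability is inherited from the
    kernel; this justifies exchanging the two integrals.\<close>
  have int: "integrable (lborel \<Otimes>\<^sub>M lborel) (\<lambda>(w, x). green_kernel s w (x - a) * f x)"
  proof (rule Bochner_Integration.integrable_bound)
    show "integrable (lborel \<Otimes>\<^sub>M lborel) (\<lambda>p. norm (case p of (w, x) \<Rightarrow> green_kernel s w (x - a)) * B)"
      by (intro integrable_mult_left integrable_norm integrable_green_kernel_pair s)
    show "(\<lambda>(w, x). green_kernel s w (x - a) * f x) \<in> borel_measurable (lborel \<Otimes>\<^sub>M lborel)"
      by measurable
  qed (use B in \<open>auto simp: norm_mult split_beta intro!: AE_I2 mult_left_mono\<close>)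
  define P where "P w = (\<integral>x. heat s w (x - a) * \<phi> x \<partial>lborel)" for w
  define Q where "Q w = exp (- s * of_real (exp w)) * P w" for w
  define D where "D w = (\<integral>x. green_kernel s w (x - a) * f x \<partial>lborel)" for w
  have D_eq: "D w = of_real (exp w) / s * exp (- s * of_real (exp w)) * (\<integral>x. heat s w (x - a) * f x \<partial>lborel)" for w
    unfolding D_def green_kernel_def by (subst integral_mult_right_zero[symmetric]) (simp only: mult.assoc)
  have "(\<integral>x. green s (x - a) * f x \<partial>lborel) = (\<integral>x. \<integral>w. green_kernel s w (x - a) * f x \<partial>lborel \<partial>lborel)"
    by (simp add: green_def)
  also have "\<dots> = (\<integral>w. D w \<partial>lborel)"
    unfolding D_def by (rule lborel_pair.Fubini_integral) (rule int)
  also have "\<dots> = (LBINT w=-\<infinity>..\<infinity>. D w)"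
    by (simp add: interval_lebesgue_integral_def set_lebesgue_integral_def einterval_def)
  \<comment> \<open>The limits of \<open>- Q\<close>: 0 at plus infinity, \<open>- \<phi> a\<close>
    at minus infinity.\<close>
  also have "\<dots> = 0 - (- \<phi> a)"
  proof (rule interval_integral_FTC_integrable)
    fix w
    show "((\<lambda>w. - Q w) has_vector_derivative D w) (at w)"
    proof -
      have s0: "s \<noteq> 0" using s by auto
      have 1: "((\<lambda>w. exp (- s * of_real (exp w))) has_vector_derivative
          - s * of_real (exp w) * exp (- s * of_real (exp w))) (at w)"
        unfolding exp_of_real[symmetric]
        by (rule has_vector_derivative_real_field) (auto intro!: derivative_eq_intros)
      have 2: "(P has_vector_derivative (\<integral>x. heat' s w (x - a) * \<phi> x \<partial>lborel)) (at w)"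
        unfolding P_def by (rule integral_heat_mult_has_derivative[OF s cont(1) supp(1)])
      have 3: "(\<integral>x. heat s w (x - a) * (\<Sum>b\<in>Basis. \<phi>'' b x) \<partial>lborel)
          = s * of_real (exp (- w)) * (\<integral>x. heat' s w (x - a) * \<phi> x \<partial>lborel)"
        by (rule integral_heat'_eq[OF s der cont supp, symmetric])
      have "(\<integral>x. heat s w (x - a) * f x \<partial>lborel)
          = (\<integral>x. s\<^sup>2 * (heat s w (x - a) * \<phi> x) - heat s w (x - a) * (\<Sum>b\<in>Basis. \<phi>'' b x) \<partial>lborel)"
        by (simp add: f_def algebra_simps)
      also have "\<dots> = s\<^sup>2 * P w - s * of_real (exp (- w)) * (\<integral>x. heat' s w (x - a) * \<phi> x \<partial>lborel)"
        unfolding P_def 3[symmetric] integral_mult_right_zero[of lborel "s\<^sup>2", symmetric]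
        by (intro Bochner_Integration.integral_diff integrable_mult_right integrable_heat_mult[OF s, where R=R])
           (use cont supp in \<open>auto intro!: continuous_intros sum.neutral\<close>)
      \<comment> \<open>In the Laplacian term the factor \<open>exp w / s\<close> of the kernel
        cancels \<open>s * exp (- w)\<close> from the heat equation. The two terms left are the
        product rule for \<open>- Q\<close>.\<close>
      finally have "D w = s * of_real (exp w) * exp (- s * of_real (exp w)) * P w
          - exp (- s * of_real (exp w)) * (\<integral>x. heat' s w (x - a) * \<phi> x \<partial>lborel)"
        unfolding D_eq using s0
        by (simp add: field_simps power2_eq_square exp_minus)
      then show ?thesis
        unfolding Q_def
        by (intro has_vector_derivative_eq_rhs[OF has_vector_derivative_minus[OF has_vector_derivative_mult[OF 1 2]]])
           simp
    qed
    show "isCont D w"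
      unfolding D_eq using s
      by (intro continuous_intros integral_heat_continuous[OF s f_cont f_supp]) auto
  next
    show "set_integrable lborel (einterval (- \<infinity>) \<infinity>) D"
      using lborel_pair.integrable_fst'[OF int] by (simp add: set_integrable_def einterval_def D_def[abs_def])
    have exp_lim: "((\<lambda>w. exp (- s * of_real (exp w))) \<longlongrightarrow> exp (- s * of_real 0)) at_bot"
      by (intro tendsto_intros exp_at_bot)
    have "((\<lambda>w. - Q w) \<longlongrightarrow> - (exp (- s * of_real 0) * \<phi> a)) at_bot"
      unfolding Q_def P_def by (intro tendsto_minus tendsto_mult exp_lim integral_heat_tendsto[OF s cont(1) B\<phi>])
    then show "(((\<lambda>w. - Q w) \<circ> real_of_ereal) \<longlongrightarrow> - \<phi> a) (at_right (- \<infinity>))"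
      by (simp add: ereal_tendsto_simps)
    have "((\<lambda>w. - Q w) \<longlongrightarrow> 0) at_top"
    proof (rule Lim_null_comparison)
      let ?C = "B\<phi> * (\<integral>x. norm (gauss s (x::'a)) \<partial>lborel)"
      have "filterlim (\<lambda>w::real. - Re s * exp w) at_bot at_top"
        using s exp_at_top by (intro filterlim_tendsto_neg_mult_at_bot[OF tendsto_const]) auto
      then show "((\<lambda>w. exp (- Re s * exp w) * ?C) \<longlongrightarrow> 0) at_top"
        by (intro tendsto_mult_left_zero filterlim_compose[OF exp_at_bot])
      show "\<forall>\<^sub>F w in at_top. norm (- Q w) \<le> exp (- Re s * exp w) * ?C"
        using integral_heat_bound[OF s cont(1) B\<phi>]
        by (simp add: Q_def P_def norm_mult norm_exp_minus_mult_of_real[simplified])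
    qed
    then show "(((\<lambda>w. - Q w) \<circ> real_of_ereal) \<longlongrightarrow> 0) (at_left \<infinity>)"
      by (simp add: ereal_tendsto_simps)
  qed auto
  finally show ?thesis
    by (simp add: f_def)
qed

section \<open>Pointwise bounds and differentiability away from the origin\<close>

lemma power_mult_exp_bounded:
  fixes b :: real
  assumes b: "b > 0"
  obtains M where "M \<ge> 0" and "\<And>q. q \<ge> 0 \<Longrightarrow> q ^ k * exp (- b * q\<^sup>2) \<le> M"
proof
  \<comment> \<open>From \<open>q ^ k \<le> 1 + (q\<^sup>2) ^ k\<close> and t <= exp t at t = b q^2
    / (k + 1). Dividing by k + 1 rather than k covers k = 0, and k t <= b q^2 still holds.\<close>
  define M where "M = 1 + (real (Suc k) / b) ^ k"
  show "M \<ge> 0" using b by (simp add: M_def)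
  fix q :: real assume q: "q \<ge> 0"
  let ?t = "b * q\<^sup>2 / real (Suc k)"
  have "q ^ k \<le> 1 + (q\<^sup>2) ^ k"
  proof (cases "q \<le> 1")
    case True
    then have "q ^ k \<le> 1" using q by (simp add: power_le_one)
    then show ?thesis using zero_le_power[OF zero_le_power2, of q k] by linarith
  next
    case False
    then have "q ^ k \<le> (q\<^sup>2) ^ k"
      using q by (intro power_mono) (simp_all add: power2_eq_square)
    then show ?thesis by simp
  qed
  also have "(q\<^sup>2) ^ k = (real (Suc k) / b) ^ k * ?t ^ k"
    using b by (simp flip: power_mult_distrib)
  also have "?t ^ k \<le> exp ?t ^ k"
  proof (rule power_mono)
    show "?t \<le> exp ?t" using exp_ge_add_one_self[of ?t] by linarith
  qed (use b in simp)
  also have "exp ?t ^ k = exp (real k * ?t)"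
    by (rule exp_of_nat_mult[symmetric])
  also have "\<dots> \<le> exp (b * q\<^sup>2)"
    using b by (simp add: field_simps)
  finally have "q ^ k \<le> 1 + (real (Suc k) / b) ^ k * exp (b * q\<^sup>2)"
    using b by (simp add: mult_left_mono)
  also have "\<dots> \<le> M * exp (b * q\<^sup>2)"
    using b by (simp add: M_def algebra_simps)
  finally show "q ^ k * exp (- b * q\<^sup>2) \<le> M"
    by (simp add: exp_minus field_simps)
qed

text \<open>In modulus, \<open>heat s w x\<close> times \<open>norm x ^ DIM('a)\<close> is a
  function of q = \<open>exp (- w / 2) * norm x\<close> alone, a constant times q^d exp (- (Re s /
  4) q^2) with d the dimension. The extra power q^k pays for factors produced by
  differentiation.\<close>

lemma heat_bound:
  assumes s: "Re s > 0"
  obtains A where "A \<ge> 0" and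
    "\<And>w x::'a::euclidean_space. norm (heat s w x) * (exp (- w / 2) * norm x) ^ k * norm x ^ DIM('a) \<le> A"
proof -
  obtain M where M: "M \<ge> 0" "\<And>q. q \<ge> 0 \<Longrightarrow> q ^ (k + DIM('a)) * exp (- (Re s / 4) * q\<^sup>2) \<le> M"
    using power_mult_exp_bounded[of "Re s / 4" "k + DIM('a)"] s by auto
  define C where "C = norm (csqrt s / of_real (2 * sqrt pi)) ^ DIM('a)"
  show thesis
  proof (rule that[of "C * M"])
    show "C * M \<ge> 0" using M by (simp add: C_def)
    fix w and x :: 'a
    let ?q = "exp (- w / 2) * norm x"
    have 1: "exp (- w) * (norm x)\<^sup>2 = ?q\<^sup>2"
      by (simp add: power_mult_distrib flip: exp_double)
    have 2: "exp (- (real DIM('a) * w / 2)) * norm x ^ DIM('a) = ?q ^ DIM('a)"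
      by (simp add: power_mult_distrib exp_of_nat_mult[symmetric])
    have "norm (heat s w x) = C * (exp (- (real DIM('a) * w / 2)) * exp (- (Re s / 4) * ?q\<^sup>2))"
      unfolding heat_def norm_mult norm_power C_def[symmetric] 1 norm_exp_eq_Re
      by (simp add: exp_diff exp_minus field_simps flip: exp_add)
    then have "norm (heat s w x) * ?q ^ k * norm x ^ DIM('a)
      = C * ((exp (- (real DIM('a) * w / 2)) * norm x ^ DIM('a)) * ?q ^ k * exp (- (Re s / 4) * ?q\<^sup>2))"
      by (simp add: mult_ac)
    also have "\<dots> = C * (?q ^ (k + DIM('a)) * exp (- (Re s / 4) * ?q\<^sup>2))"
      unfolding 2 by (simp add: power_add mult_ac)
    also have "\<dots> \<le> C * M"
      by (intro mult_left_mono M) (auto simp: C_def)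
    finally show "norm (heat s w x) * ?q ^ k * norm x ^ DIM('a) \<le> C * M" .
  qed
qed

text \<open>Away from 0 this is a majorant in \<open>w\<close> that is integrable and uniform in
  \<open>x\<close>: \<open>k = 0\<close> serves the kernel itself, \<open>k = 2\<close> its
  gradient.\<close>

lemma green_kernel_bound:
  assumes s: "Re s > 0"
  obtains A where "A \<ge> 0" and
    "\<And>w x::'a::euclidean_space. norm (green_kernel s w x) * (exp (- w / 2) * norm x) ^ k * norm x ^ DIM('a)
      \<le> A * (exp w * exp (- Re s * exp w))"
proof -
  obtain A where A: "A \<ge> 0"
    "\<And>w x::'a. norm (heat s w x) * (exp (- w / 2) * norm x) ^ k * norm x ^ DIM('a) \<le> A"
    using heat_bound[OF s] by blast
  show thesis
  proof (rule that[of "A / norm s"])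
    show "A / norm s \<ge> 0" using A by simp
    fix w and x :: 'a
    have "norm (green_kernel s w x) * (exp (- w / 2) * norm x) ^ k * norm x ^ DIM('a) =
      (norm (heat s w x) * (exp (- w / 2) * norm x) ^ k * norm x ^ DIM('a)) * (exp w * exp (- Re s * exp w) / norm s)"
      unfolding green_kernel_def norm_mult norm_exp_minus_mult_of_real by (simp add: norm_divide mult_ac)
    also have "\<dots> \<le> A * (exp w * exp (- Re s * exp w) / norm s)"
      by (intro mult_right_mono A) auto
    finally show "norm (green_kernel s w x) * (exp (- w / 2) * norm x) ^ k * norm x ^ DIM('a)
        \<le> A / norm s * (exp w * exp (- Re s * exp w))" by simp
  qed
qed

lemma integrable_green_kernel:
  assumes s: "Re s > 0" and x: "(x::'a::euclidean_space) \<noteq> 0"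
  shows "integrable lborel (\<lambda>w. green_kernel s w x)"
proof -
  obtain A where A: "\<And>w x::'a. norm (green_kernel s w x) * (exp (- w / 2) * norm x) ^ 0 * norm x ^ DIM('a)
      \<le> A * (exp w * exp (- Re s * exp w))" "A \<ge> 0"
    using green_kernel_bound[OF s, of 0] by metis
  show ?thesis
  proof (rule Bochner_Integration.integrable_bound)
    show "integrable lborel (\<lambda>w. A / norm x ^ DIM('a) * (exp w * exp (- Re s * exp w)))"
      by (intro integrable_mult_right integrable_exp_exp s)
    show "AE w in lborel. norm (green_kernel s w x) \<le> norm (A / norm x ^ DIM('a) * (exp w * exp (- Re s * exp w)))"
      using A(1)[of _ x] A(2) x by (intro AE_I2) (simp add: field_simps)
  qed measurable
qed

text \<open>The power is far from sharp at both ends and is not locally integrable at 0;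
  integrability is the matter of \<open>integrable_green\<close>. The bound serves points at a
  positive distance from the source and the decay at infinity.\<close>

lemma green_bound:
  assumes s: "Re s > 0"
  obtains A where "A \<ge> 0" and "\<And>x::'a::euclidean_space. x \<noteq> 0 \<Longrightarrow> norm (green s x) \<le> A / norm x ^ DIM('a)"
proof -
  obtain A where A: "\<And>w x::'a. norm (green_kernel s w x) * (exp (- w / 2) * norm x) ^ 0 * norm x ^ DIM('a)
      \<le> A * (exp w * exp (- Re s * exp w))" "A \<ge> 0"
    using green_kernel_bound[OF s, of 0] by metis
  let ?I = "\<integral>w. exp w * exp (- Re s * exp w) \<partial>lborel"
  show thesis
  proof (rule that[of "A * ?I"])
    show "A * ?I \<ge> 0" using A(2) by simp
    fix x :: 'a assume x: "x \<noteq> 0"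
    have "norm (green s x) \<le> (\<integral>w. A / norm x ^ DIM('a) * (exp w * exp (- Re s * exp w)) \<partial>lborel)"
      unfolding green_def
    proof (rule order_trans[OF integral_norm_bound], rule integral_mono)
      show "integrable lborel (\<lambda>w. norm (green_kernel s w x))"
        by (intro integrable_norm integrable_green_kernel s x)
      show "integrable lborel (\<lambda>w. A / norm x ^ DIM('a) * (exp w * exp (- Re s * exp w)))"
        by (intro integrable_mult_right integrable_exp_exp s)
      show "norm (green_kernel s w x) \<le> A / norm x ^ DIM('a) * (exp w * exp (- Re s * exp w))" for w
        using A(1)[of w x] x by (simp add: field_simps)
    qed
    then show "norm (green s x) \<le> A * ?I / norm x ^ DIM('a)" by simp
  qed
qed

text \<open>The value of the derivative is left open because on the boundary the normal derivatives
  of the two mirror sources cancel.\<close>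

lemma green_differentiable_along_Basis:
  assumes s: "Re s > 0" and x: "(x::'a::euclidean_space) \<noteq> 0" and b: "b \<in> Basis"
  obtains D where "((\<lambda>t. green s (x + t *\<^sub>R b)) has_vector_derivative D) (at 0)"
proof -
  obtain A where A: "\<And>w x::'a. norm (green_kernel s w x) * (exp (- w / 2) * norm x) ^ 2 * norm x ^ DIM('a)
      \<le> A * (exp w * exp (- Re s * exp w))" "A \<ge> 0"
    using green_kernel_bound[OF s, of 2] by metis
  \<comment> \<open>For increments below half of \<open>norm x\<close> the segment stays at distance
    at least \<open>r\<close> from the singularity.\<close>
  define r where "r = norm x / 2"
  have r: "r > 0" using x by (simp add: r_def)
  have far: "norm (x + t *\<^sub>R b) \<ge> r" if "t \<in> ball 0 r" for t
    using that norm_triangle_ineq2[of x "- (t *\<^sub>R b)"] b by (simp add: r_def)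
  let ?f' = "\<lambda>t w. green_kernel s w (x + t *\<^sub>R b) * (- s * of_real (exp (- w) * ((x + t *\<^sub>R b) \<bullet> b) / 2))"
  have "((\<lambda>t. \<integral>w. green_kernel s w (x + t *\<^sub>R b) \<partial>lborel) has_vector_derivative (\<integral>w. ?f' 0 w \<partial>lborel)) (at 0)"
  proof (rule has_vector_derivative_integral[where \<delta>=r and f'="?f'"
        and g="\<lambda>w. (A * norm s / (2 * r ^ Suc DIM('a))) * (exp w * exp (- Re s * exp w))"])
    fix t w :: real assume t: "t \<in> ball 0 r"
    define y where "y = x + t *\<^sub>R b"
    have y: "norm y \<ge> r" "y \<noteq> 0" using far[OF t] r by (auto simp: y_def)
    show "integrable lborel (\<lambda>w. green_kernel s w (x + t *\<^sub>R b))"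
      using y(2) unfolding y_def by (intro integrable_green_kernel s)
    show "((\<lambda>t. green_kernel s w (x + t *\<^sub>R b)) has_vector_derivative ?f' t w) (at t)"
      unfolding green_kernel_def mult.assoc
      by (rule has_vector_derivative_along_line[where f="\<lambda>x. green_kernel s w x" for w, unfolded green_kernel_def mult.assoc])
         (intro has_vector_derivative_mult_right heat_directional_derivative b)
    have "norm (?f' t w) \<le> norm (green_kernel s w y) * (norm s * (exp (- w) * norm y / 2))"
      using Basis_le_norm[OF b, of y] unfolding y_def[symmetric] norm_mult
      by (intro mult_left_mono) (auto simp: norm_mult intro!: mult_left_mono)
    \<comment> \<open>\<open>exp (- w) * norm y\<close> is the square of
      \<open>exp (- w / 2) * norm y\<close> divided by \<open>norm y\<close>; hence
      \<open>k = 2\<close> and the exponent \<open>Suc DIM('a)\<close>.\<close>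
    also have "\<dots> = (norm (green_kernel s w y) * (exp (- w / 2) * norm y) ^ 2 * norm y ^ DIM('a))
        * (norm s / (2 * norm y ^ Suc DIM('a)))"
      using y(2) by (simp add: field_simps power2_eq_square flip: exp_add)
    also have "\<dots> \<le> (A * (exp w * exp (- Re s * exp w))) * (norm s / (2 * r ^ Suc DIM('a)))"
      using y r A(2) by (intro mult_mono A divide_left_mono) (auto intro!: power_mono mult_mono)
    finally show "norm (?f' t w) \<le> (A * norm s / (2 * r ^ Suc DIM('a))) * (exp w * exp (- Re s * exp w))"
      by (simp add: mult_ac)
  next
    show "integrable lborel (\<lambda>w. (A * norm s / (2 * r ^ Suc DIM('a))) * (exp w * exp (- Re s * exp w)))"
      by (intro integrable_mult_right integrable_exp_exp s)
  qed (rule r)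
  then show thesis
    using that by (simp add: green_def)
qed

section \<open>Macdonald functions and the impedance part\<close>

text \<open>\<open>cosh (\<kappa> * u)\<close> is the even part of
  \<open>exp (- \<kappa> * u)\<close> and \<open>cosh u\<close> is even, so the half-line integral
  is half of the integral over the line. The latter is the form that the kernel integral takes after
  a translation.\<close>

lemma macdonald_eq_integral_UNIV:
  assumes int: "integrable lborel (\<lambda>u. exp (- z * of_real (cosh u)) * of_real (exp (- \<kappa> * u)))"
  shows "2 * macdonald \<kappa> z = (\<integral>u. exp (- z * of_real (cosh u)) * of_real (exp (- \<kappa> * u)) \<partial>lborel)"
proof -
  let ?h = "\<lambda>u. exp (- z * of_real (cosh u)) * complex_of_real (exp (- \<kappa> * u))"
  let ?f = "\<lambda>u. exp (- z * of_real (cosh u)) * complex_of_real (cosh (\<kappa> * u))"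
  have int': "integrable lborel (\<lambda>u. ?h (- u))"
    using lborel_integrable_real_affine[OF int, of "-1" 0] by simp
  have f_eq: "?f = (\<lambda>u. (1/2) * (?h u + ?h (- u)))"
    by (simp add: fun_eq_iff cosh_field_def field_simps)
  have f_int: "integrable lborel ?f"
    unfolding f_eq using int int' by (intro integrable_mult_right Bochner_Integration.integrable_add)
  have "(\<integral>u. ?f u \<partial>lborel) = (1/2) * ((\<integral>u. ?h u \<partial>lborel) + (\<integral>u. ?h (- u) \<partial>lborel))"
    unfolding f_eq using int int' by (subst integral_mult_right_zero) (subst Bochner_Integration.integral_add, auto)
  also have "(\<integral>u. ?h (- u) \<partial>lborel) = (\<integral>u. ?h u \<partial>lborel)"
    using lborel_integral_real_affine[of "-1" ?h 0] by simp
  finally have f_h: "(\<integral>u. ?f u \<partial>lborel) = (\<integral>u. ?h u \<partial>lborel)" by simp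
  have set_int: "set_integrable lborel {0..} ?f"
    unfolding set_integrable_def using f_int by (intro integrable_mult_indicator) auto
  have "macdonald \<kappa> z = (LINT u:{0..}|lborel. ?f u)"
    unfolding macdonald_def by (rule set_borel_integral_eq_integral(2)[symmetric]) (rule set_int)
  moreover have "has_bochner_integral lborel ?f (2 *\<^sub>R (LINT u:{0..}|lborel. ?f u))"
    using set_int unfolding set_integrable_def set_lebesgue_integral_def
    by (intro has_bochner_integral_even_function) (auto intro: has_bochner_integral_integrable)
  ultimately show ?thesis
    using f_h by (simp add: has_bochner_integral_iff scaleR_conv_of_real)
qed

text \<open>Links the two ways of writing half-integer powers: \<open>powr\<close> in
  \<open>g_full\<close>, an integer power of \<open>csqrt s\<close> in \<open>heat\<close>. Both use
  the principal logarithm, so no sign is lost.\<close>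

lemma powr_half_DIM:
  assumes "s \<noteq> 0" and "\<kappa> = real d / 2 - 1"
  shows "s powr of_real \<kappa> = csqrt s ^ d / s"
proof -
  have "complex_of_real \<kappa> = of_nat d / 2 - 1"
    using assms by simp
  then have "of_real \<kappa> * Ln s = of_nat d * (Ln s / 2) - Ln s"
    by (simp add: left_diff_distrib)
  then have "s powr of_real \<kappa> = exp (of_nat d * (Ln s / 2)) / exp (Ln s)"
    using assms by (simp add: powr_def exp_diff)
  also have "exp (of_nat d * (Ln s / 2)) = csqrt s ^ d"
    using assms by (simp only: exp_of_nat_mult csqrt_exp_Ln not_False_eq_True)
  finally show ?thesis using assms by simp
qed

lemma powr_mult_of_real:
  fixes s :: complex
  assumes "r > 0"
  shows "(s * of_real r) powr of_real a = s powr of_real a * of_real (r powr a)"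
proof -
  have "(of_real r * s) powr of_real a = of_real r powr of_real a * s powr of_real a"
    using assms by (intro powr_times_real_left) auto
  then show ?thesis
    using assms by (simp add: powr_of_real mult.commute)
qed

lemma powr_divide_of_real:
  fixes s :: complex
  assumes r: "r > 0"
  shows "(s / of_real r) powr of_real a = s powr of_real a / of_real (r powr a)"
proof -
  have "inverse r powr a = inverse (r powr a)"
    using r by (simp add: inverse_powr)
  then show ?thesis
    using powr_mult_of_real[of "inverse r" s a] r by (simp add: divide_inverse)
qed

text \<open>With r = \<open>norm x\<close>, the translation w = ln (r / 2) + u balances the two
  exponents: \<open>exp w\<close> and \<open>exp (- w) * r\<^sup>2 / 4\<close> become (r / 2) exp u
  and (r / 2) exp (- u), with sum r cosh u. The other powers of exp w combine to exp (- \<kappa> w),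
  as \<kappa> = d/2 - 1, and \<open>C\<close> collects what is independent of u.\<close>

lemma g_full_eq_green:
  fixes x :: "'a::euclidean_space"
  assumes s: "Re s > 0" and x: "x \<noteq> 0" and \<nu>: "\<nu> = (real DIM('a) - 3) / 2"
  shows "g_full \<nu> s (norm x) = green s x"
proof -
  define \<rho> where "\<rho> = norm x"
  define \<kappa> where "\<kappa> = \<nu> + 1/2"
  define C where "C = (csqrt s / of_real (2 * sqrt pi)) ^ DIM('a) / s * of_real ((\<rho> / 2) powr (- \<kappa>))"
  have \<rho>: "\<rho> > 0" using x by (simp add: \<rho>_def)
  have s0: "s \<noteq> 0" using s by auto
  have \<kappa>: "\<kappa> = real DIM('a) / 2 - 1" by (simp add: \<kappa>_def \<nu> field_simps)
  have C0: "C \<noteq> 0" using s0 \<rho> by (simp add: C_def)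
  have kernel: "green_kernel s (ln (\<rho> / 2) + 1 * u) x =
      C * (exp (- (s * of_real \<rho>) * of_real (cosh u)) * of_real (exp (- \<kappa> * u)))" for u
  proof -
    let ?w = "ln (\<rho> / 2) + 1 * u"
    have e: "exp ?w = \<rho> / 2 * exp u" "exp (- ?w) = 2 / \<rho> * exp (- u)"
      using \<rho> by (simp_all add: exp_add exp_minus exp_diff field_simps)
    have 1: "exp ?w + exp (- ?w) * (norm x)\<^sup>2 / 4 = \<rho> * cosh u"
      unfolding e \<rho>_def[symmetric] using \<rho> by (simp add: cosh_field_def field_simps power2_eq_square)
    have 2: "exp ?w * exp (- (real DIM('a) * ?w / 2)) = (\<rho> / 2) powr (- \<kappa>) * exp (- \<kappa> * u)"
      using \<rho> by (simp add: powr_def \<kappa> algebra_simps add_divide_distrib diff_divide_distrib flip: exp_add)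
    have "green_kernel s ?w x = (csqrt s / of_real (2 * sqrt pi)) ^ DIM('a) / s
        * of_real (exp ?w * exp (- (real DIM('a) * ?w / 2)))
        * exp (- s * of_real (exp ?w + exp (- ?w) * (norm x)\<^sup>2 / 4))"
      unfolding green_kernel_def heat_def exp_diff distrib_left of_real_add exp_add of_real_mult
      by (simp add: exp_minus exp_of_real[symmetric] field_simps)
    also have "\<dots> = C * (exp (- (s * of_real \<rho>) * of_real (cosh u)) * of_real (exp (- \<kappa> * u)))"
      unfolding 1 2 C_def by (simp add: mult_ac)
    finally show ?thesis .
  qed
  have "integrable lborel (\<lambda>u. green_kernel s (ln (\<rho> / 2) + 1 * u) x)"
    by (intro lborel_integrable_real_affine integrable_green_kernel s x) simp
  then have "integrable lborel (\<lambda>u. inverse C * (C * (exp (- (s * of_real \<rho>) * of_real (cosh u)) * of_real (exp (- \<kappa> * u)))))"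
    unfolding kernel by (rule integrable_mult_right)
  then have int: "integrable lborel (\<lambda>u. exp (- (s * of_real \<rho>) * of_real (cosh u)) * of_real (exp (- \<kappa> * u)))"
    using C0 by (simp add: mult.assoc[symmetric])
  have "green s x = (\<integral>u. green_kernel s (ln (\<rho> / 2) + 1 * u) x \<partial>lborel)"
    unfolding green_def using lborel_integral_real_affine[of 1 "\<lambda>w. green_kernel s w x" "ln (\<rho> / 2)"] by simp
  also have "\<dots> = C * (2 * macdonald \<kappa> (s * of_real \<rho>))"
    unfolding kernel integral_mult_right_zero macdonald_eq_integral_UNIV[OF int] ..
  \<comment> \<open>Matching constants: (4 pi)^(\<kappa> + 1) = 2 * 2^\<kappa> * (2 pi)^(\<kappa> +
    1). The factor 2 is the one from the even integrand, and 2^\<kappa> cancels against (r / 2)^(-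
    \<kappa>).\<close>
  also have "2 * C = of_real (1 / (2 * pi) powr (\<nu> + 3/2)) * (s / of_real \<rho>) powr of_real (\<nu> + 1/2)"
  proof -
    have 1: "(2 * sqrt pi) ^ DIM('a) = (4 * pi) powr (\<kappa> + 1)"
    proof -
      have "(2 * sqrt pi) ^ DIM('a) = (sqrt (4 * pi)) powr (real DIM('a))"
        by (simp add: real_sqrt_mult powr_realpow)
      also have "\<dots> = (4 * pi) powr (\<kappa> + 1)"
        by (simp add: powr_half_sqrt[symmetric] powr_powr \<kappa>)
      finally show ?thesis .
    qed
    have 2: "2 * inverse ((2 * sqrt pi) ^ DIM('a)) * (\<rho> / 2) powr (- \<kappa>) = 1 / (2 * pi) powr (\<nu> + 3/2) / \<rho> powr \<kappa>"
    proof -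
      have "(4 * pi) powr (\<kappa> + 1) = (2 * 2 powr \<kappa>) * (2 * pi) powr (\<kappa> + 1)"
        using powr_mult[of 2 "2 * pi" "\<kappa> + 1"] by (simp add: powr_add)
      moreover have "(\<rho> / 2) powr (- \<kappa>) = 2 powr \<kappa> / \<rho> powr \<kappa>"
        using \<rho> by (simp add: powr_minus powr_divide field_simps)
      moreover have \<nu>': "\<nu> + 3/2 = \<kappa> + 1" by (simp add: \<kappa>_def)
      ultimately show ?thesis
        unfolding 1 \<nu>' by (simp add: field_simps)
    qed
    have "2 * C = (csqrt s ^ DIM('a) / s) * of_real (2 * inverse ((2 * sqrt pi) ^ DIM('a)) * (\<rho> / 2) powr (- \<kappa>))"
      by (simp add: C_def power_divide field_simps)
    also have "\<dots> = s powr of_real \<kappa> * of_real (1 / (2 * pi) powr (\<nu> + 3/2) / \<rho> powr \<kappa>)"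
      unfolding 2 powr_half_DIM[OF s0 \<kappa>] ..
    also have "\<dots> = of_real (1 / (2 * pi) powr (\<nu> + 3/2)) * (s / of_real \<rho>) powr of_real \<kappa>"
      using \<rho> by (simp add: powr_divide_of_real)
    finally show ?thesis by (simp add: \<kappa>_def)
  qed
  then have "C * (2 * macdonald \<kappa> (s * of_real \<rho>)) = g_full \<nu> s \<rho>"
    unfolding g_full_def \<kappa>_def[symmetric] by (metis mult.assoc mult.commute)
  finally show ?thesis
    by (simp add: \<rho>_def)
qed

section \<open>The impedance part as a field of sources on a vertical ray\<close>

lemma set_integrable_exp_minus_atLeast:
  assumes "c > (0::real)"
  shows "set_integrable lborel {a..} (\<lambda>t. exp (- c * t))"
proof -
  have "(\<lambda>t. exp (- c * t)) absolutely_integrable_on {a..}"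
    using integrable_on_exp_minus_to_infinity[OF assms] by (subst absolutely_integrable_on_iff_nonneg) auto
  then show ?thesis
    unfolding set_integrable_def by (subst (asm) integrable_completion) auto
qed

abbreviation last_axis :: "real^'n::{finite,linorder}" where
  "last_axis \<equiv> axis last_index 1"

lemma last_axis_Basis: "last_axis \<in> Basis"
  by (simp add: axis_in_Basis_iff)

text \<open>\<open>mu z t\<close> is the norm of \<open>z\<close> moved vertically to height
  \<open>t\<close>; so the Macdonald function in \<open>psi\<close> is evaluated along a vertical
  ray.\<close>

lemma mu_eq_norm: "mu z t = norm (z + (t - z $ last_index) *\<^sub>R last_axis)"
proof -
  let ?w = "z + (t - z $ last_index) *\<^sub>R last_axis"
  have "?w $ last_index = t" by (simp add: axis_def)
  moreover have "tangential ?w = tangential z"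
    by (simp add: tangential_def vec_eq_iff axis_def)
  ultimately show ?thesis
    using norm_eq_mu[of ?w] by (simp add: mu_def)
qed

lemma mu_ge: "t \<ge> 0 \<Longrightarrow> mu z t \<ge> t"
  unfolding mu_def by (rule real_le_rsqrt) simp

context
  fixes \<nu> \<beta> :: real and s :: complex and z :: "real^'n::{finite,linorder}"
  assumes nu: "\<nu> = (real CARD('n) - 3) / 2" and beta: "\<beta> > 0" and s: "Re s > 0" and z: "z \<in> half_space"
begin

text \<open>On the ray the distance to the origin is at least \<open>z $ last_index\<close>, so
  \<open>green\<close> is bounded there and the exponential makes the product integrable.\<close>

lemma set_integrable_exp_green:
  "set_integrable lborel {z $ last_index..} (\<lambda>t. exp (- s * of_real \<beta> * of_real t) * green s (z + (t - z $ last_index) *\<^sub>R last_axis))"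
proof -
  let ?a = "z $ last_index"
  have a: "?a > 0" using z by (simp add: half_space_def)
  obtain A where A: "A \<ge> 0" "\<And>x::(real, 'n) vec. x \<noteq> 0 \<Longrightarrow> norm (green s x) \<le> A / norm x ^ DIM((real, 'n) vec)"
    using green_bound[OF s] by metis
  have [measurable]: "(green s :: (real, 'n) vec \<Rightarrow> complex) \<in> borel_measurable borel"
    by (rule measurable_green)
  have le: "norm (green s (z + (t - ?a) *\<^sub>R last_axis)) \<le> A / ?a ^ DIM((real, 'n) vec)" if "t \<ge> ?a" for t
  proof -
    let ?x = "z + (t - ?a) *\<^sub>R last_axis"
    have ge: "norm ?x \<ge> ?a"
      using mu_ge[of t z] that a by (simp add: mu_eq_norm)
    then have "norm (green s ?x) \<le> A / norm ?x ^ DIM((real, 'n) vec)"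
      using a by (intro A) auto
    also have "\<dots> \<le> A / ?a ^ DIM((real, 'n) vec)"
      using ge a A(1) by (intro divide_left_mono power_mono mult_pos_pos zero_less_power) auto
    finally show ?thesis .
  qed
  have "integrable lborel (\<lambda>t. (A / ?a ^ DIM((real, 'n) vec)) * (indicator {?a..} t *\<^sub>R exp (- (Re s * \<beta>) * t)))"
    using set_integrable_exp_minus_atLeast[of "Re s * \<beta>" ?a] s beta unfolding set_integrable_def
    by (intro integrable_mult_right) simp
  then show ?thesis
    unfolding set_integrable_def
  proof (rule Bochner_Integration.integrable_bound)
    show "(\<lambda>t. indicator {?a..} t *\<^sub>R (exp (- s * of_real \<beta> * of_real t) * green s (z + (t - ?a) *\<^sub>R last_axis)))
        \<in> borel_measurable lborel"
      by measurable
    show "AE t in lborel. norm (indicator {?a..} t *\<^sub>R (exp (- s * of_real \<beta> * of_real t) * green s (z + (t - ?a) *\<^sub>R last_axis)))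
      \<le> norm ((A / ?a ^ DIM((real, 'n) vec)) * (indicator {?a..} t *\<^sub>R exp (- (Re s * \<beta>) * t)))"
    proof (rule AE_I2)
      fix t
      show "norm (indicator {?a..} t *\<^sub>R (exp (- s * of_real \<beta> * of_real t) * green s (z + (t - ?a) *\<^sub>R last_axis)))
        \<le> norm ((A / ?a ^ DIM((real, 'n) vec)) * (indicator {?a..} t *\<^sub>R exp (- (Re s * \<beta>) * t)))"
      proof (cases "t \<ge> ?a")
        case True
        have "norm (exp (- s * of_real \<beta> * of_real t)) = exp (- (Re s * \<beta>) * t)"
          by (simp add: norm_exp_eq_Re)
        then show ?thesis
          using mult_right_mono[OF le[OF True], of "exp (- (Re s * \<beta>) * t)"] True A(1) a
          by (simp add: norm_mult abs_mult mult_ac)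
      qed simp
    qed
  qed
qed

text \<open>The lower order \<open>\<nu> - 1/2\<close> of the power is what leaves a single factor
  \<open>m\<close>; the Jacobian of the substitution in \<open>psi\<close> removes it.\<close>

lemma macdonald_eq_g_full:
  assumes m: "m > 0"
  shows "macdonald (\<nu> + 1/2) (s * of_real m) / (s * of_real m) powr of_real (\<nu> - 1/2) =
    of_real m * (s * of_real ((2 * pi) powr (\<nu> + 3/2)) / (s powr of_real (\<nu> + 1/2))\<^sup>2 * g_full \<nu> s m)"
proof -
  let ?\<kappa> = "\<nu> + 1/2"
  have s0: "s \<noteq> 0" using s by auto
  have "complex_of_real (\<nu> - 1/2) = of_real ?\<kappa> - 1" by simp
  then have "(s * of_real m) powr of_real (\<nu> - 1/2) = (s * of_real m) powr of_real ?\<kappa> / (s * of_real m)"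
    using s0 m by (simp only: powr_diff) simp
  also have "(s * of_real m) powr of_real ?\<kappa> = s powr of_real ?\<kappa> * of_real (m powr ?\<kappa>)"
    by (rule powr_mult_of_real[OF m])
  finally have 1: "(s * of_real m) powr of_real (\<nu> - 1/2) = s powr of_real ?\<kappa> * of_real (m powr ?\<kappa>) / (s * of_real m)" .
  have 2: "g_full \<nu> s m = of_real (1 / (2 * pi) powr (\<nu> + 3/2)) * (s powr of_real ?\<kappa> / of_real (m powr ?\<kappa>))
      * macdonald ?\<kappa> (s * of_real m)"
    unfolding g_full_def powr_divide_of_real[OF m] ..
  have nz: "s powr of_real ?\<kappa> \<noteq> 0" "complex_of_real (m powr ?\<kappa>) \<noteq> 0"
      "complex_of_real ((2 * pi) powr (\<nu> + 3/2)) \<noteq> 0"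
    using s0 m by simp_all
  show ?thesis
    unfolding 1 2 using s0 m nz by (simp add: field_simps power2_eq_square)
qed

lemma g_full_mu:
  assumes "t \<ge> z $ last_index"
  shows "g_full \<nu> s (mu z t) = green s (z + (t - z $ last_index) *\<^sub>R last_axis)"
proof -
  have "mu z t > 0"
    using mu_ge[of t z] assms z by (simp add: half_space_def)
  then show ?thesis
    unfolding mu_eq_norm using s nu by (intro g_full_eq_green) auto
qed

text \<open>The substitution has derivative \<beta> + t / \<mu> = (t + \<beta> \<mu>) / \<mu>, whose
  numerator cancels the denominator in \<open>psi\<close> and whose denominator cancels the factor
  from \<open>macdonald_eq_g_full\<close>. In the exponent, - y + \<mu> is affine in t, so only exp
  (- s \<beta> t) and a constant factor survive.\<close>

lemma psi_eq:
  "psi \<nu> \<beta> s z = exp (s * of_real (norm z + \<beta> * z $ last_index))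
      * (s * of_real ((2 * pi) powr (\<nu> + 3/2)) / (s powr of_real (\<nu> + 1/2))\<^sup>2)
      * (LINT t:{z $ last_index..}|lborel. exp (- s * of_real \<beta> * of_real t) * green s (z + (t - z $ last_index) *\<^sub>R last_axis))"
proof -
  let ?a = "z $ last_index"
  let ?F = "\<lambda>t. exp (- s * of_real \<beta> * of_real t) * green s (z + (t - ?a) *\<^sub>R last_axis)"
  define C where "C = exp (s * of_real (norm z + \<beta> * ?a))
      * (s * of_real ((2 * pi) powr (\<nu> + 3/2)) / (s powr of_real (\<nu> + 1/2))\<^sup>2)"
  define f where "f y = exp (- s * of_real y) / of_real (t_map \<beta> z y + \<beta> * mu_tilde \<beta> z y)
       * (exp (s * of_real (mu_tilde \<beta> z y))
            * macdonald (\<nu> + 1/2) (s * of_real (mu_tilde \<beta> z y))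
          / (s * of_real (mu_tilde \<beta> z y)) powr of_real (\<nu> - 1/2))" for y
  have a: "?a > 0" using z by (simp add: half_space_def)
  have mu_pos: "mu z t > 0" if "t \<in> {?a..}" for t
    using mu_ge[of t z] that a by simp
  note bij = bij_betw_y_map[OF beta z]
  have t_map: "t_map \<beta> z (y_map \<beta> z t) = t" if "t \<in> {?a..}" for t
    unfolding t_map_def by (rule the_inv_into_f_f[OF bij_betw_imp_inj_on[OF bij] that])
  have pointwise: "\<bar>\<beta> + t / mu z t\<bar> *\<^sub>R f (y_map \<beta> z t) = C * ?F t" if t: "t \<in> {?a..}" for t
  proof -
    let ?m = "mu z t"
    have m: "?m > 0" by (rule mu_pos[OF t])
    have t0: "t > 0" using t a by simp
    have pos: "t + \<beta> * ?m > 0" using t0 m beta by (simp add: add_pos_pos)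
    have jac: "\<bar>\<beta> + t / ?m\<bar> = (t + \<beta> * ?m) / ?m"
      using t0 m beta by (simp add: field_simps)
    have "exp (- s * of_real (y_map \<beta> z t)) * exp (s * of_real ?m)
        = exp (s * of_real (norm z + \<beta> * ?a)) * exp (- s * of_real \<beta> * of_real t)"
      unfolding y_map_def by (simp add: algebra_simps flip: exp_add)
    then have "exp (- s * of_real (y_map \<beta> z t)) * exp (s * of_real ?m) *
        (macdonald (\<nu> + 1/2) (s * of_real ?m) / (s * of_real ?m) powr of_real (\<nu> - 1/2)) = of_real ?m * (C * ?F t)"
      using t unfolding macdonald_eq_g_full[OF m] C_def by (simp add: g_full_mu mult_ac)
    moreover have "f (y_map \<beta> z t) = exp (- s * of_real (y_map \<beta> z t)) * exp (s * of_real ?m) *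
        (macdonald (\<nu> + 1/2) (s * of_real ?m) / (s * of_real ?m) powr of_real (\<nu> - 1/2)) / of_real (t + \<beta> * ?m)"
      unfolding f_def mu_tilde_def t_map[OF t] by (simp only: divide_inverse mult_ac)
    ultimately have "f (y_map \<beta> z t) = of_real ?m * (C * ?F t) / of_real (t + \<beta> * ?m)"
      by (simp only:)
    then show ?thesis
      unfolding jac scaleR_conv_of_real using m pos by (simp del: of_real_add)
  qed
  have abs_int: "(\<lambda>t. C * ?F t) absolutely_integrable_on {?a..}"
    using set_integrable_mult_right[OF set_integrable_exp_green, of C]
    unfolding set_integrable_def by (subst integrable_completion) auto
  have der: "(y_map \<beta> z has_real_derivative \<beta> + t / mu z t) (at t within {?a..})" if t: "t \<in> {?a..}" for t
  proof -
    have "(norm (tangential z))\<^sup>2 + t\<^sup>2 > 0"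
      using mu_pos[OF t] by (simp add: mu_def)
    then show ?thesis
      unfolding y_map_def[abs_def] mu_def
      by (auto intro!: derivative_eq_intros simp: field_simps)
  qed
  \<comment> \<open>The change of variables is an equivalence: absolute integrability in
    \<open>t\<close> also shows that the integral defining \<open>psi\<close> exists.\<close>
  have "integral {0..} f = integral {?a..} (\<lambda>t. C * ?F t)"
  proof -
    have "(\<lambda>t. \<bar>\<beta> + t / mu z t\<bar> *\<^sub>R f (y_map \<beta> z t)) absolutely_integrable_on {?a..} \<longleftrightarrow>
        (\<lambda>t. C * ?F t) absolutely_integrable_on {?a..}"
      by (intro set_integrable_cong refl) (rule pointwise)
    moreover have "integral {?a..} (\<lambda>t. \<bar>\<beta> + t / mu z t\<bar> *\<^sub>R f (y_map \<beta> z t)) = integral {?a..} (\<lambda>t. C * ?F t)"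
      by (rule Henstock_Kurzweil_Integration.integral_cong) (rule pointwise)
    ultimately show ?thesis
      using has_absolute_integral_change_of_variables_real[OF _ der bij_betw_imp_inj_on[OF bij], of f]
        abs_int bij_betw_imp_surj_on[OF bij] by auto
  qed
  also have "\<dots> = (LINT t:{?a..}|lborel. C * ?F t)"
    by (intro set_borel_integral_eq_integral(2)[symmetric] set_integrable_mult_right set_integrable_exp_green)
  also have "\<dots> = C * (LINT t:{?a..}|lborel. ?F t)"
    by (rule set_integral_mult_right)
  finally show ?thesis
    unfolding psi_def f_def[symmetric] C_def .
qed

lemma G_imp_eq:
  "G_imp \<nu> \<beta> s z = - 2 * of_real \<beta> * s * exp (s * of_real \<beta> * of_real (z $ last_index))
    * (LINT t:{z $ last_index..}|lborel. exp (- s * of_real \<beta> * of_real t) * green s (z + (t - z $ last_index) *\<^sub>R last_axis))"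
proof -
  let ?\<kappa> = "\<nu> + 1/2"
  let ?I = "LINT t:{z $ last_index..}|lborel. exp (- s * of_real \<beta> * of_real t) * green s (z + (t - z $ last_index) *\<^sub>R last_axis)"
  have s0: "s \<noteq> 0" using s by auto
  \<comment> \<open>Valid because |arg s| < pi/2, so doubling the argument does not leave the
    principal strip.\<close>
  have "Ln (s\<^sup>2) = 2 * Ln s"
    using s s0 Re_Ln_pos_lt_imp[OF s] unfolding power2_eq_square by (subst Ln_times_simple) auto
  then have "(s\<^sup>2) powr of_real ?\<kappa> = (s powr of_real ?\<kappa>)\<^sup>2"
    using s0 by (simp add: powr_def mult_ac flip: exp_double)
  then have 1: "(s\<^sup>2 / of_real (2 * pi)) powr of_real ?\<kappa> = (s powr of_real ?\<kappa>)\<^sup>2 / of_real ((2 * pi) powr ?\<kappa>)"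
    by (subst powr_divide_of_real) simp_all
  have 2: "(2 * pi) powr (\<nu> + 3/2) = 2 * pi * (2 * pi) powr ?\<kappa>"
  proof -
    have "\<nu> + 3/2 = 1 + ?\<kappa>" by simp
    then show ?thesis by (simp only: powr_add) simp
  qed
  have 3: "exp (s * of_real (norm z + \<beta> * z $ last_index)) = exp (s * of_real (norm z)) * exp (s * of_real \<beta> * of_real (z $ last_index))"
    by (simp add: algebra_simps flip: exp_add)
  have nz: "s powr of_real ?\<kappa> \<noteq> 0" "complex_of_real ((2 * pi) powr ?\<kappa>) \<noteq> 0"
    using s0 by simp_all
  show ?thesis
    unfolding G_imp_def psi_eq 1 2 3 using nz
    by (simp add: exp_minus field_simps)
qed

text \<open>Here the range of integration is independent of \<open>z\<close>, which suits Fubini and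
  estimates. The form \<open>G_imp_eq\<close>, with the moving lower limit, is the one to
  differentiate in the normal direction.\<close>

lemma G_imp_eq_shift:
  "G_imp \<nu> \<beta> s z = - 2 * of_real \<beta> * s *
    (\<integral>\<tau>. indicator {0..} \<tau> *\<^sub>R (exp (- s * of_real \<beta> * of_real \<tau>) * green s (z + \<tau> *\<^sub>R last_axis)) \<partial>lborel)"
proof -
  let ?a = "z $ last_index"
  let ?h = "\<lambda>t. indicator {?a..} t *\<^sub>R (exp (- s * of_real \<beta> * of_real t) * green s (z + (t - ?a) *\<^sub>R last_axis))"
  have shift: "?h (?a + 1 * \<tau>) = exp (- s * of_real \<beta> * of_real ?a) *
      (indicator {0..} \<tau> *\<^sub>R (exp (- s * of_real \<beta> * of_real \<tau>) * green s (z + \<tau> *\<^sub>R last_axis)))" for \<tau>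
    by (simp add: indicator_def algebra_simps flip: exp_add)
  show ?thesis
    unfolding G_imp_eq set_lebesgue_integral_def
    by (subst lborel_integral_real_affine[of 1 ?h ?a])
       (simp_all only: shift integral_mult_right_zero abs_one scaleR_one one_neq_zero not_False_eq_True,
        simp add: exp_minus)
qed

end

section \<open>The half-space problem\<close>

lemma vector_derivative_line_eq_0:
  fixes f :: "'a::real_normed_vector \<Rightarrow> 'b::real_normed_vector"
  assumes "closed K" and zero: "\<And>y. y \<notin> K \<Longrightarrow> f y = 0" and x: "x \<notin> K"
  shows "vector_derivative (\<lambda>h. f (x + h *\<^sub>R b)) (at 0) = 0"
proof (rule vector_derivative_at)
  have "open ((\<lambda>h. x + h *\<^sub>R b) -` (- K))"
    using assms(1) by (intro open_vimage continuous_intros) auto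
  then show "((\<lambda>h. f (x + h *\<^sub>R b)) has_vector_derivative 0) (at 0)"
    using x zero by (intro has_vector_derivative_transform_within_open[OF has_vector_derivative_const]) auto
qed

lemma differentiable_has_line_derivative:
  fixes f :: "'a::real_normed_vector \<Rightarrow> 'b::real_normed_vector"
  assumes "f differentiable (at x)"
  shows "((\<lambda>h. f (x + h *\<^sub>R b)) has_vector_derivative vector_derivative (\<lambda>h. f (x + h *\<^sub>R b)) (at 0)) (at 0)"
proof -
  have "(\<lambda>h. x + h *\<^sub>R b) differentiable (at 0)" by (intro derivative_intros)
  then have "f \<circ> (\<lambda>h. x + h *\<^sub>R b) differentiable (at 0)"
    using assms by (intro differentiable_chain_at) auto
  then show ?thesis by (simp add: vector_derivative_works o_def)
qed

lemma Basis_vec_eq: "(Basis :: (real^'n) set) = range (\<lambda>i. axis i 1)"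
  by (auto simp: Basis_vec_def)

text \<open>Translates coordinate-indexed partial derivatives into derivatives along
  \<open>Basis\<close> vectors, the form in which \<open>green_fundamental_solution\<close> is
  stated. All derivatives vanish off the closed support because its complement is open.\<close>

lemma
  assumes \<phi>: "test_function U \<phi>"
  shows test_function_continuous: "continuous_on UNIV \<phi>"
    and test_function_laplacian_continuous: "continuous_on UNIV (laplacian \<phi>)"
    and test_function_eq_0: "\<And>x. x \<notin> U \<Longrightarrow> \<phi> x = 0"
    and test_function_laplacian_eq_0: "\<And>x. x \<notin> U \<Longrightarrow> laplacian \<phi> x = 0"
    and test_function_bounded: "\<exists>B. \<forall>x. norm (\<phi> x) \<le> B"
    and test_function_laplacian_bounded: "\<exists>B. \<forall>x. norm (laplacian \<phi> x) \<le> B"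
    and test_function_green: "Re s > 0 \<Longrightarrow> (\<integral>x. green s (x - a) * (s\<^sup>2 * \<phi> x - laplacian \<phi> x) \<partial>lborel) = \<phi> a"
proof -
  define \<phi>1 where "\<phi>1 b x = vector_derivative (\<lambda>h. \<phi> (x + h *\<^sub>R b)) (at 0)" for b x
  define \<phi>2 where "\<phi>2 b x = vector_derivative (\<lambda>h. \<phi>1 b (x + h *\<^sub>R b)) (at 0)" for b x
  define K where "K = closure {x. \<phi> x \<noteq> 0}"
  have pd: "partial_deriv i \<phi> = \<phi>1 (axis i 1)" "partial_deriv i (partial_deriv i \<phi>) = \<phi>2 (axis i 1)" for i
    by (simp_all add: fun_eq_iff partial_deriv_def \<phi>1_def \<phi>2_def)
  have lap: "laplacian \<phi> x = (\<Sum>b\<in>Basis. \<phi>2 b x)" for x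
    unfolding laplacian_def Basis_vec_eq pd(2)
    by (subst sum.reindex) (auto simp: inj_on_def axis_eq_axis)
  have C2: "C_k (Suc (Suc 0)) \<phi>" and K: "compact K" "K \<subseteq> U"
    using \<phi> unfolding test_function_def K_def by blast+
  have diff: "\<phi> differentiable (at x)" "\<phi>1 (axis i 1) differentiable (at x)"
      "continuous_on UNIV (\<phi>2 (axis i 1))" for x i
    using C2 by (auto simp flip: pd)
  have der1: "((\<lambda>t. \<phi> (x + t *\<^sub>R b)) has_vector_derivative \<phi>1 b x) (at 0)" for b x
    unfolding \<phi>1_def by (rule differentiable_has_line_derivative) (rule diff)
  have der2: "((\<lambda>t. \<phi>1 b (x + t *\<^sub>R b)) has_vector_derivative \<phi>2 b x) (at 0)" if "b \<in> Basis" for b x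
    using that diff(2) unfolding Basis_vec_eq \<phi>2_def by (auto intro!: differentiable_has_line_derivative)
  have cont: "continuous_on UNIV \<phi>" "b \<in> Basis \<Longrightarrow> continuous_on UNIV (\<phi>1 b)" for b
    using diff(1,2) unfolding Basis_vec_eq
    by (auto intro!: continuous_at_imp_continuous_on differentiable_imp_continuous_within)
  have cont2: "continuous_on UNIV (\<phi>2 b)" if "b \<in> Basis" for b
    using that diff(3) unfolding Basis_vec_eq by auto
  have closed: "closed K" using K compact_imp_closed by blast
  have supp0: "\<phi> x = 0" if "x \<notin> K" for x
    using that closure_subset[of "{x. \<phi> x \<noteq> 0}"] unfolding K_def by blast
  have supp1: "\<phi>1 b x = 0" if "x \<notin> K" for b x
    unfolding \<phi>1_def by (rule vector_derivative_line_eq_0[OF closed supp0 that])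
  have supp2: "\<phi>2 b x = 0" if "x \<notin> K" for b x
    unfolding \<phi>2_def by (rule vector_derivative_line_eq_0[OF closed supp1 that])
  obtain R where R: "\<And>x. norm x > R \<Longrightarrow> x \<notin> K"
    using compact_imp_bounded[OF K(1)] unfolding bounded_iff by (meson not_le)
  show "continuous_on UNIV \<phi>" by (rule cont)
  show lap_cont: "continuous_on UNIV (laplacian \<phi>)"
    unfolding lap[abs_def] by (intro continuous_intros cont2)
  show "\<phi> x = 0" if "x \<notin> U" for x using that supp0 K by blast
  have lap_supp: "laplacian \<phi> x = 0" if "x \<notin> K" for x
    using that supp2 unfolding lap by (intro sum.neutral) blast
  then show "laplacian \<phi> x = 0" if "x \<notin> U" for x
    using that K by blast
  show "\<exists>B. \<forall>x. norm (\<phi> x) \<le> B"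
    using bounded_continuous_compact_support[OF cont(1) supp0[OF R]] by blast
  show "\<exists>B. \<forall>x. norm (laplacian \<phi> x) \<le> B"
    using bounded_continuous_compact_support[OF lap_cont lap_supp[OF R]] by blast
  show "(\<integral>x. green s (x - a) * (s\<^sup>2 * \<phi> x - laplacian \<phi> x) \<partial>lborel) = \<phi> a" if s: "Re s > 0"
    unfolding lap
  proof (rule green_fundamental_solution[OF s, where \<phi>'=\<phi>1 and R=R])
    show "((\<lambda>t. \<phi>1 b (x + t *\<^sub>R b)) has_vector_derivative \<phi>2 b x) (at 0)" if "b \<in> Basis" for b x
      by (rule der2[OF that])
    show "\<phi> x = 0" "\<phi>1 b x = 0" "\<phi>2 b x = 0" if "norm x > R" for b x
      using R[OF that] by (rule supp0 supp1 supp2)+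
  qed (rule der1 cont cont2; assumption?)+
qed

lemma half_space_nonzero: "x \<in> half_space \<Longrightarrow> x \<noteq> 0"
  by (auto simp: half_space_def)

lemma reflect_eq: "reflect y = y - (2 * y $ last_index) *\<^sub>R last_axis"
  by (simp add: reflect_def vec_eq_iff axis_def)

text \<open>At \<open>0\<close>, \<open>g_full\<close> takes the junk value \<open>0\<close>, since \<open>s / 0 = 0\<close> and \<open>0 powr a = 0\<close>.\<close>
lemma g_full_norm:
  fixes x :: "'a::euclidean_space"
  assumes "Re s > 0" and "\<nu> = (real DIM('a) - 3) / 2"
  shows "g_full \<nu> s (norm x) = (if x = 0 then 0 else green s x)"
  using g_full_eq_green[OF assms(1) _ assms(2)] by (auto simp: g_full_def)

section \<open>Extension to the whole space and the distributional equation\<close>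

context
  fixes \<nu> \<beta> :: real and s :: complex and y :: "real^'n::{finite,linorder}"
  assumes nu: "\<nu> = (real CARD('n) - 3) / 2" and beta: "\<beta> > 0" and s: "Re s > 0" and y: "y \<in> half_space"
begin

text \<open>The indicator is part of the kernel so that Fubini applies to \<open>lborel\<close> on
  the full product.\<close>

definition imp_kernel :: "(real, 'n) vec \<Rightarrow> real \<Rightarrow> complex" where
  "imp_kernel x \<tau> = indicator {0..} \<tau> *\<^sub>R (exp (- s * of_real \<beta> * of_real \<tau>) * green s (x - reflect y + \<tau> *\<^sub>R last_axis))"

lemma diff_reflect_half_space: "x $ last_index \<ge> 0 \<Longrightarrow> x - reflect y \<in> half_space"
  using y by (simp add: half_space_def reflect_def)

lemma reflect_notin_half_space: "\<tau> \<ge> 0 \<Longrightarrow> reflect y - \<tau> *\<^sub>R last_axis \<notin> half_space"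
  using y by (simp add: half_space_def reflect_def axis_def)

lemma integrable_exp_indicator:
  "integrable lborel (\<lambda>\<tau>. indicator {0..} \<tau> * exp (- (Re s * \<beta>) * \<tau>))"
  using set_integrable_exp_minus_atLeast[of "Re s * \<beta>" 0] s beta by (simp add: set_integrable_def)

lemma measurable_imp_kernel [measurable]:
  "(\<lambda>(x, \<tau>). imp_kernel x \<tau>) \<in> borel_measurable (borel \<Otimes>\<^sub>M borel)"
  unfolding imp_kernel_def by measurable

text \<open>For fixed \<open>\<tau>\<close> this is a translate of \<open>green s\<close>, whose L1
  norm is translation invariant; only the exponential weight remains to be integrated in
  \<open>\<tau>\<close>.\<close>

lemma integrable_imp_kernel: "integrable (lborel \<Otimes>\<^sub>M lborel) (\<lambda>(x, \<tau>). imp_kernel x \<tau>)"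
proof -
  have green: "green s (x - reflect y + \<tau> *\<^sub>R last_axis) = green s (x - (reflect y - \<tau> *\<^sub>R last_axis))" for x \<tau>
    by (simp add: algebra_simps)
  have "integrable (lborel \<Otimes>\<^sub>M lborel) (\<lambda>(\<tau>, x). imp_kernel x \<tau>)"
  proof (rule lborel_pair.Fubini_integrable)
    have "(\<integral>x. norm (imp_kernel x \<tau>) \<partial>lborel)
        = indicator {0..} \<tau> * exp (- (Re s * \<beta>) * \<tau>) * (\<integral>x. norm (green s (x::(real, 'n) vec)) \<partial>lborel)" for \<tau>
    proof -
      have "norm (imp_kernel x \<tau>) = (indicator {0..} \<tau> * exp (- (Re s * \<beta>) * \<tau>)) * norm (green s (x - (reflect y - \<tau> *\<^sub>R last_axis)))" for x
        by (simp add: imp_kernel_def norm_mult norm_exp_eq_Re green)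
      then show ?thesis
        using integral_lborel_affine[of 1 "\<lambda>x. norm (green s (x - (reflect y - \<tau> *\<^sub>R last_axis)))" "reflect y - \<tau> *\<^sub>R last_axis"]
        by simp
    qed
    then show "integrable lborel (\<lambda>\<tau>. \<integral>x. norm (case (\<tau>, x) of (\<tau>, x) \<Rightarrow> imp_kernel x \<tau>) \<partial>lborel)"
      using integrable_exp_indicator by simp
    show "AE \<tau> in lborel. integrable lborel (\<lambda>x. case (\<tau>, x) of (\<tau>, x) \<Rightarrow> imp_kernel x \<tau>)"
      unfolding imp_kernel_def green prod.case
      by (intro AE_I2 integrable_scaleR_right integrable_mult_right integrable_green s)
  qed measurable
  from lborel_pair.integrable_product_swap[OF this] show ?thesis by simp
qed

text \<open>Continues \<open>G_half\<close> to all of space, where the convolution identities live;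
  the representation of \<open>G_imp\<close> through \<open>psi\<close> is established only on the
  half-space. The case \<open>x = y\<close> reproduces the value of \<open>g_full\<close> at 0, so
  that the two agree at every point of the half-space.\<close>

definition green_sum :: "(real, 'n) vec \<Rightarrow> complex" where
  "green_sum x = (if x - y = 0 then 0 else green s (x - y)) + green s (x - reflect y)
    - 2 * of_real \<beta> * s * (\<integral>\<tau>. imp_kernel x \<tau> \<partial>lborel)"

lemma G_half_eq_green_sum:
  assumes x: "x \<in> half_space"
  shows "G_half \<nu> \<beta> s x y = green_sum x"
proof -
  have z: "x - reflect y \<in> half_space"
    using x by (intro diff_reflect_half_space) (simp add: half_space_def)
  then have "x - reflect y \<noteq> 0" by (auto simp: half_space_def)
  then show ?thesis
    unfolding G_half_def green_sum_def imp_kernel_def G_imp_eq_shift[OF nu beta s z]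
    using s nu by (simp add: g_full_norm)
qed

lemma integrable_green_sum: "integrable lborel green_sum"
proof -
  have "integrable lborel (\<lambda>x. if x - y = 0 then 0 else green s (x - y))"
  proof (rule integrable_cong_AE_imp[OF integrable_green[OF s, of y]])
    show "AE x in lborel. green s (x - y) = (if x - y = 0 then 0 else green s (x - y))"
      using AE_lborel_singleton[of y] by eventually_elim simp
  qed measurable
  then show ?thesis
    unfolding green_sum_def[abs_def]
    using lborel_pair.integrable_fst'[OF integrable_imp_kernel]
    by (intro Bochner_Integration.integrable_add Bochner_Integration.integrable_diff integrable_mult_right
        integrable_green s) simp_all
qed

lemma integral_green_sum:
  assumes \<phi>: "test_function half_space \<phi>"
  shows "(\<integral>x. green_sum x * (s\<^sup>2 * \<phi> x - laplacian \<phi> x) \<partial>lborel) = \<phi> y"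
proof -
  define f where "f x = s\<^sup>2 * \<phi> x - laplacian \<phi> x" for x
  have f_cont: "continuous_on UNIV f"
    unfolding f_def using test_function_continuous[OF \<phi>] test_function_laplacian_continuous[OF \<phi>]
    by (intro continuous_intros)
  then have [measurable]: "f \<in> borel_measurable borel"
    by (rule borel_measurable_continuous_onI)
  obtain B1 B2 where "\<And>x. norm (\<phi> x) \<le> B1" "\<And>x. norm (laplacian \<phi> x) \<le> B2"
    using test_function_bounded[OF \<phi>] test_function_laplacian_bounded[OF \<phi>] by blast
  then have B: "norm (f x) \<le> norm s ^ 2 * B1 + B2" for x
    unfolding f_def by (intro order_trans[OF norm_triangle_ineq4] add_mono) (auto simp: norm_mult norm_power mult_left_mono)
  \<comment> \<open>Multiplication by the bounded \<open>f\<close> preserves integrability; used on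
    the space itself and, with \<open>h = fst\<close>, on the product with the
    \<open>\<tau>\<close>-line.\<close>
  have int: "integrable M (\<lambda>p. g p * f (h p))" if g: "integrable M g" and [measurable]: "h \<in> borel_measurable M"
    for M :: "'c measure" and g h
  proof (rule Bochner_Integration.integrable_bound)
    show "integrable M (\<lambda>p. norm (g p) * (norm s ^ 2 * B1 + B2))"
      by (intro integrable_mult_left integrable_norm g)
    show "(\<lambda>p. g p * f (h p)) \<in> borel_measurable M"
      using borel_measurable_integrable[OF g] by measurable
    show "AE p in M. norm (g p * f (h p)) \<le> norm (norm (g p) * (norm s ^ 2 * B1 + B2))"
      using B by (intro AE_I2) (auto simp: norm_mult intro!: mult_left_mono order_trans[OF _ abs_ge_self])
  qed
  have I: "(\<integral>x. green s (x - a) * f x \<partial>lborel) = \<phi> a" for a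
    unfolding f_def by (rule test_function_green[OF \<phi> s])
  have imp: "(\<integral>x. (\<integral>\<tau>. imp_kernel x \<tau> \<partial>lborel) * f x \<partial>lborel) = 0"
  proof -
    have "integrable (lborel \<Otimes>\<^sub>M lborel) (\<lambda>(x, \<tau>). imp_kernel x \<tau> * f x)"
      using int[OF integrable_imp_kernel, of fst] by (simp add: case_prod_unfold)
    then have "(\<integral>x. (\<integral>\<tau>. imp_kernel x \<tau> * f x \<partial>lborel) \<partial>lborel) = (\<integral>\<tau>. (\<integral>x. imp_kernel x \<tau> * f x \<partial>lborel) \<partial>lborel)"
      by (rule lborel_pair.Fubini_integral[symmetric])
    also have "\<dots> = (\<integral>\<tau>. 0 \<partial>(lborel :: real measure))"
    proof (intro Bochner_Integration.integral_cong refl)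
      fix \<tau> :: real
      have "(\<integral>x. imp_kernel x \<tau> * f x \<partial>lborel) = (of_real (indicator {0..} \<tau>) * exp (- s * of_real \<beta> * of_real \<tau>))
          * (\<integral>x. green s (x - (reflect y - \<tau> *\<^sub>R last_axis)) * f x \<partial>lborel)"
        unfolding imp_kernel_def scaleR_conv_of_real
        by (subst integral_mult_right_zero[symmetric]) (simp add: algebra_simps)
      \<comment> \<open>Either \<open>\<tau> < 0\<close> and the indicator is 0, or the source lies
        outside the half-space, where \<open>\<phi>\<close> is 0.\<close>
      also have "\<dots> = 0"
        unfolding I using test_function_eq_0[OF \<phi> reflect_notin_half_space] by (simp add: indicator_def)
      finally show "(\<integral>x. imp_kernel x \<tau> * f x \<partial>lborel) = 0" .
    qed
    finally show ?thesis by simp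
  qed
  have "(\<integral>x. green_sum x * f x \<partial>lborel) =
      (\<integral>x. green s (x - y) * f x + green s (x - reflect y) * f x
        - 2 * of_real \<beta> * s * ((\<integral>\<tau>. imp_kernel x \<tau> \<partial>lborel) * f x) \<partial>lborel)"
  \<comment> \<open>The integrands can differ only at \<open>x = y\<close>, a null set.\<close>
  proof (rule integral_cong_AE)
    show "(\<lambda>x. green_sum x * f x) \<in> borel_measurable lborel"
      using borel_measurable_integrable[OF integrable_green_sum] by measurable
    show "AE x in lborel. green_sum x * f x = green s (x - y) * f x + green s (x - reflect y) * f x
        - 2 * of_real \<beta> * s * ((\<integral>\<tau>. imp_kernel x \<tau> \<partial>lborel) * f x)"
      using AE_lborel_singleton[of y] by eventually_elim (simp add: green_sum_def algebra_simps)
  qed measurable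
  also have "\<dots> = \<phi> y + \<phi> (reflect y) - 2 * of_real \<beta> * s * 0"
  proof -
    have "integrable lborel (\<lambda>x. (\<integral>\<tau>. imp_kernel x \<tau> \<partial>lborel) * f x)"
      using int[OF lborel_pair.integrable_fst'[OF integrable_imp_kernel], of "\<lambda>x. x"] by simp
    moreover have "integrable lborel (\<lambda>x. green s (x - a) * f x)" for a
      using int[OF integrable_green[OF s], of "\<lambda>x. x"] by simp
    ultimately show ?thesis
      by (simp add: I imp)
  qed
  also have "\<phi> (reflect y) = 0"
    using test_function_eq_0[OF \<phi> reflect_notin_half_space[of 0]] by simp
  finally show ?thesis by (simp add: f_def)
qed

lemma locally_integrable_G_half: "locally_integrable half_space (\<lambda>x. G_half \<nu> \<beta> s x y)"
  unfolding locally_integrable_def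
proof (intro allI impI)
  fix K :: "(real, 'n) vec set" assume K: "compact K \<and> K \<subseteq> half_space"
  then have "K \<in> sets borel" by (simp add: borel_compact)
  then have "set_integrable lborel K green_sum"
    unfolding set_integrable_def by (intro integrable_mult_indicator integrable_green_sum) simp
  moreover have "set_integrable lborel K green_sum = set_integrable lborel K (\<lambda>x. G_half \<nu> \<beta> s x y)"
    using K by (intro set_integrable_cong refl) (auto simp: G_half_eq_green_sum)
  ultimately show "set_integrable lborel K (\<lambda>x. G_half \<nu> \<beta> s x y)" by simp
qed

lemma G_half_distribution:
  assumes \<phi>: "test_function half_space \<phi>"
  shows "- laplacian_distribution (regular_distribution half_space (\<lambda>x. G_half \<nu> \<beta> s x y)) \<phi>
    + s\<^sup>2 * regular_distribution half_space (\<lambda>x. G_half \<nu> \<beta> s x y) \<phi> = dirac y \<phi>"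
proof -
  \<comment> \<open>The integral over the half-space is the integral over the whole space since the
    test function vanishes outside.\<close>
  have reg: "regular_distribution half_space (\<lambda>x. G_half \<nu> \<beta> s x y) \<psi> = (\<integral>x. green_sum x * \<psi> x \<partial>lborel)"
    if "\<And>x. x \<notin> half_space \<Longrightarrow> \<psi> x = 0" for \<psi>
    unfolding regular_distribution_def set_lebesgue_integral_def
    by (intro Bochner_Integration.integral_cong refl) (use that in \<open>auto simp: indicator_def G_half_eq_green_sum\<close>)
  have int: "integrable lborel (\<lambda>x. green_sum x * \<psi> x)"
    if cont: "continuous_on UNIV \<psi>" and bounded: "\<exists>B. \<forall>x. norm (\<psi> x) \<le> B" for \<psi>
  proof -
    have [measurable]: "\<psi> \<in> borel_measurable borel"
      using cont by (rule borel_measurable_continuous_onI)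
    obtain B where B: "\<And>x. norm (\<psi> x) \<le> B" using bounded by blast
    show ?thesis
    proof (rule Bochner_Integration.integrable_bound)
      show "integrable lborel (\<lambda>x. norm (green_sum x) * B)"
        by (intro integrable_mult_left integrable_norm integrable_green_sum)
      show "(\<lambda>x. green_sum x * \<psi> x) \<in> borel_measurable lborel"
        using borel_measurable_integrable[OF integrable_green_sum] by measurable
      show "AE x in lborel. norm (green_sum x * \<psi> x) \<le> norm (norm (green_sum x) * B)"
        using B by (intro AE_I2) (auto simp: norm_mult intro!: mult_left_mono order_trans[OF _ abs_ge_self])
    qed
  qed
  note int_\<phi> = int[OF test_function_continuous[OF \<phi>] test_function_bounded[OF \<phi>]]
  note int_lap = int[OF test_function_laplacian_continuous[OF \<phi>] test_function_laplacian_bounded[OF \<phi>]]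
  have "(\<integral>x. green_sum x * (s\<^sup>2 * \<phi> x - laplacian \<phi> x) \<partial>lborel)
      = (\<integral>x. s\<^sup>2 * (green_sum x * \<phi> x) - green_sum x * laplacian \<phi> x \<partial>lborel)"
    by (simp add: algebra_simps)
  also have "\<dots> = s\<^sup>2 * (\<integral>x. green_sum x * \<phi> x \<partial>lborel) - (\<integral>x. green_sum x * laplacian \<phi> x \<partial>lborel)"
    using int_\<phi> int_lap by simp
  finally show ?thesis
    unfolding laplacian_distribution_def dirac_def
    by (simp add: reg test_function_eq_0[OF \<phi>] test_function_laplacian_eq_0[OF \<phi>] integral_green_sum[OF \<phi>])
qed

section \<open>The Robin condition on the boundary\<close>

lemma green_along_last_has_derivative:
  fixes p :: "(real, 'n) vec"
  assumes "p $ last_index + u \<noteq> 0"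
  obtains D where "((\<lambda>t. green s (p + t *\<^sub>R last_axis)) has_vector_derivative D) (at u)"
proof -
  have "(p + u *\<^sub>R last_axis) $ last_index \<noteq> 0"
    using assms by (simp add: axis_def)
  then have "p + u *\<^sub>R last_axis \<noteq> 0" by force
  from green_differentiable_along_Basis[OF s this last_axis_Basis]
  obtain D where "((\<lambda>t. green s (p + u *\<^sub>R last_axis + t *\<^sub>R last_axis)) has_vector_derivative D) (at 0)"
    by blast
  from has_vector_derivative_along_line[OF this] that show thesis by blast
qed

text \<open>On the normal line through \<open>x\<close> everything is a function of height. At
  displacement \<open>h\<close> along the outward normal, the source and its mirror image are at
  vertical distances a + h and a - h, so their derivatives at 0 are D and - D. What remains is E' =
  - (s \<beta> E(0) + 2 s \<beta> \<Gamma>(a)), which is - s \<beta> F(0) because F(0) = 2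
  \<Gamma>(a) + E(0).\<close>

lemma G_half_boundary_condition:
  assumes x: "x \<in> half_space_boundary"
  obtains D where "((\<lambda>h. G_half \<nu> \<beta> s (x + h *\<^sub>R outward_normal) y) has_vector_derivative D) (at 0)"
    and "D + s * of_real \<beta> * G_half \<nu> \<beta> s x y = 0"
proof -
  define a where "a = y $ last_index"
  \<comment> \<open>The horizontal offset of \<open>x\<close> from \<open>y\<close>, with last
    coordinate 0.\<close>
  define p where "p = x - y + a *\<^sub>R last_axis"
  define \<Gamma> where "\<Gamma> t = green s (p + t *\<^sub>R last_axis)" for t
  define k where "k t = exp (- s * of_real \<beta> * of_real t) * \<Gamma> t" for t
  define L where "L u = (LINT t:{u..}|lborel. k t)" for u
  define E where "E h = - 2 * of_real \<beta> * s * exp (s * of_real \<beta> * of_real (a - h)) * L (a - h)" for h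
  have a: "a > 0" using y by (simp add: a_def half_space_def)
  have p0: "p $ last_index = 0"
    using x by (simp add: p_def a_def axis_def half_space_boundary_def)
  have \<Gamma>_diff: "\<exists>D. (\<Gamma> has_vector_derivative D) (at u)" if "u > 0" for u
    using green_along_last_has_derivative[of p u] that p0 unfolding \<Gamma>_def[abs_def] by auto
  have k_cont: "continuous_on {u..} k" if "u > 0" for u
    unfolding continuous_on_eq_continuous_within
  proof
    fix t assume "t \<in> {u..}"
    with \<Gamma>_diff[of t] that have "isCont \<Gamma> t" by (auto intro: has_vector_derivative_continuous)
    then have "isCont k t" unfolding k_def by (intro continuous_intros)
    then show "continuous (at t within {u..}) k" by (rule continuous_at_imp_continuous_at_within)
  qed
  have half: "p + u *\<^sub>R last_axis \<in> half_space" if "u > 0" for u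
    using that p0 by (simp add: half_space_def axis_def)
  have last: "(p + u *\<^sub>R last_axis) $ last_index = u" for u
    using p0 by (simp add: axis_def)
  have shift: "p + u *\<^sub>R last_axis + (t - u) *\<^sub>R last_axis = p + t *\<^sub>R last_axis" for u t
    by (simp add: algebra_simps)
  have G_imp: "G_imp \<nu> \<beta> s (p + (a - h) *\<^sub>R last_axis) = E h" if "h < a" for h
    using G_imp_eq[OF nu beta s half[of "a - h"]] that
    by (simp only: last shift E_def L_def k_def \<Gamma>_def diff_gt_0_iff_gt simp_thms)
  have k_int: "set_integrable lborel {u..} k" if "u > 0" for u
    using set_integrable_exp_green[OF nu beta s half[OF that]]
    unfolding last shift k_def[abs_def] \<Gamma>_def .
  \<comment> \<open>The base point \<open>a / 2\<close> stays away from 0, where \<open>k\<close> is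
    singular if \<open>x\<close> lies directly below \<open>y\<close>. The finite integral is then
    differentiated by the fundamental theorem.\<close>
  have L_eq: "L u = L (a / 2) - integral {a / 2..u} k" if u: "u > a / 2" for u
  proof -
    have sub: "set_integrable lborel {a / 2..u} k"
      using a by (intro set_integrable_subset[OF k_int[of "a / 2"]]) auto
    have disj: "{a / 2..u} \<inter> {u<..} = {}" by auto
    have "{a / 2..} = {a / 2..u} \<union> {u<..}" using u by auto
    moreover have "set_integrable lborel {u<..} k"
      using a u by (intro set_integrable_subset[OF k_int[of u]]) auto
    ultimately have "L (a / 2) = (LINT t:{a / 2..u}|lborel. k t) + (LINT t:{u<..}|lborel. k t)"
      unfolding L_def using sub by (simp add: set_integral_Un[OF disj])
    also have "(LINT t:{u<..}|lborel. k t) = L u"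
      unfolding L_def set_lebesgue_integral_def
    proof (rule integral_cong_AE)
      show "AE t in lborel. indicator {u<..} t *\<^sub>R k t = indicator {u..} t *\<^sub>R k t"
        using AE_lborel_singleton[of u] by eventually_elim (auto simp: indicator_def)
      show "(\<lambda>t. indicator {u..} t *\<^sub>R k t) \<in> borel_measurable lborel"
        using k_int[of u] u a by (auto simp: set_integrable_def)
      show "(\<lambda>t. indicator {u<..} t *\<^sub>R k t) \<in> borel_measurable lborel"
        using \<open>set_integrable lborel {u<..} k\<close> by (auto simp: set_integrable_def)
    qed
    finally show ?thesis
      using set_borel_integral_eq_integral(2)[OF sub] by simp
  qed
  have L': "(L has_vector_derivative - k a) (at a)"
  proof -
    have "((\<lambda>u. integral {a / 2..u} k) has_vector_derivative k a) (at a within {a / 2..2 * a})"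
      using a by (intro integral_has_vector_derivative continuous_on_subset[OF k_cont[of "a / 2"]]) auto
    then have "((\<lambda>u. integral {a / 2..u} k) has_vector_derivative k a) (at a)"
      using a by (simp add: at_within_Icc_at)
    from has_vector_derivative_diff[OF has_vector_derivative_const[of "L (a / 2)"] this]
    have "((\<lambda>u. L (a / 2) - integral {a / 2..u} k) has_vector_derivative - k a) (at a)" by simp
    then show ?thesis
      by (rule has_vector_derivative_transform_within_open[where S="{a / 2<..}"]) (use a L_eq in auto)
  qed
  have sub': "((\<lambda>h. a - h) has_vector_derivative - 1) (at 0)"
    by (auto intro!: derivative_eq_intros)
  have comp: "((\<lambda>h. f (a - h)) has_vector_derivative - D) (at 0)" if "(f has_vector_derivative D) (at a)" for f :: "real \<Rightarrow> complex" and D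
    using vector_diff_chain_at[OF sub', of f D] that by (simp add: o_def)
  have comp': "((\<lambda>h. f (a + h)) has_vector_derivative D) (at 0)" if "(f has_vector_derivative D) (at a)" for f :: "real \<Rightarrow> complex" and D
  proof -
    have "((\<lambda>h. a + h) has_vector_derivative 1) (at 0)"
      by (auto intro!: derivative_eq_intros)
    from vector_diff_chain_at[OF this, of f D] that show ?thesis by (simp add: o_def)
  qed
  have exp': "((\<lambda>u. exp (s * of_real \<beta> * of_real u)) has_vector_derivative
      s * of_real \<beta> * exp (s * of_real \<beta> * of_real a)) (at a)"
    by (rule has_vector_derivative_real_field) (auto intro!: derivative_eq_intros)
  have E': "(E has_vector_derivative - (s * of_real \<beta> * E 0 + 2 * of_real \<beta> * s * \<Gamma> a)) (at 0)"
  proof -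
    have "((\<lambda>u. - 2 * of_real \<beta> * s * (exp (s * of_real \<beta> * of_real u) * L u)) has_vector_derivative
        - 2 * of_real \<beta> * s * (exp (s * of_real \<beta> * of_real a) * - k a + s * of_real \<beta> * exp (s * of_real \<beta> * of_real a) * L a)) (at a)"
      by (intro has_vector_derivative_mult_right has_vector_derivative_mult exp' L')
    from comp[OF this] have "(E has_vector_derivative
        - (- 2 * of_real \<beta> * s * (exp (s * of_real \<beta> * of_real a) * - k a + s * of_real \<beta> * exp (s * of_real \<beta> * of_real a) * L a))) (at 0)"
      unfolding E_def[abs_def] by (simp only: mult.assoc)
    moreover have "exp (s * of_real \<beta> * of_real a) * k a = \<Gamma> a"
      unfolding k_def by (simp add: exp_minus)
    then have "- 2 * of_real \<beta> * s * (exp (s * of_real \<beta> * of_real a) * - k a + s * of_real \<beta> * exp (s * of_real \<beta> * of_real a) * L a)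
        = s * of_real \<beta> * E 0 + 2 * of_real \<beta> * s * \<Gamma> a"
      unfolding E_def by (simp add: distrib_left) (simp add: algebra_simps)
    ultimately show ?thesis by (simp only:)
  qed
  obtain D where D: "(\<Gamma> has_vector_derivative D) (at a)"
    using \<Gamma>_diff[OF a] by blast
  define F where "F h = \<Gamma> (a + h) + \<Gamma> (a - h) + E h" for h
  have F': "(F has_vector_derivative D + - D + - (s * of_real \<beta> * E 0 + 2 * of_real \<beta> * s * \<Gamma> a)) (at 0)"
    unfolding F_def[abs_def] by (intro has_vector_derivative_add comp comp' D E')
  \<comment> \<open>The formula holds on both sides of the boundary: for 0 < h < a the point has
    left the half-space but is still above the mirror image of \<open>y\<close>. So the derivative
    is two-sided.\<close>
  have G_eq: "G_half \<nu> \<beta> s (x + h *\<^sub>R outward_normal) y = F h" if h: "\<bar>h\<bar> < a" for h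
  proof -
    have n1: "x + h *\<^sub>R outward_normal - y = p - (a + h) *\<^sub>R last_axis"
      by (simp add: p_def outward_normal_def algebra_simps)
    have n2: "x + h *\<^sub>R outward_normal - reflect y = p + (a - h) *\<^sub>R last_axis"
    proof -
      have "(2 * a) *\<^sub>R last_axis = a *\<^sub>R last_axis + a *\<^sub>R (last_axis :: (real, 'n) vec)"
        by (simp flip: scaleR_add_left)
      then show ?thesis
        by (simp add: p_def outward_normal_def reflect_eq flip: a_def) (simp add: algebra_simps)
    qed
    have inner: "p \<bullet> last_axis = 0"
      using p0 by (simp add: inner_axis)
    \<comment> \<open>\<open>p\<close> is horizontal, so reversing the vertical component does not
      change the norm.\<close>
    have "norm (p - (a + h) *\<^sub>R last_axis) = norm (p + (a + h) *\<^sub>R last_axis)"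
      by (simp add: norm_eq_sqrt_inner inner_diff inner_add inner inner_commute[of last_axis p] algebra_simps)
    then have "g_full \<nu> s (norm (x + h *\<^sub>R outward_normal - y)) = g_full \<nu> s (norm (p + (a + h) *\<^sub>R last_axis))"
      by (simp only: n1)
    also have "\<dots> = \<Gamma> (a + h)"
      unfolding \<Gamma>_def using h nu
      by (intro g_full_eq_green s half_space_nonzero half) auto
    finally have 1: "g_full \<nu> s (norm (x + h *\<^sub>R outward_normal - y)) = \<Gamma> (a + h)" .
    have 2: "g_full \<nu> s (norm (p + (a - h) *\<^sub>R last_axis)) = \<Gamma> (a - h)"
      unfolding \<Gamma>_def using h nu
      by (intro g_full_eq_green s half_space_nonzero half) auto
    show ?thesis
      using h unfolding G_half_def 1 n2 2 F_def by (simp add: G_imp)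
  qed
  show thesis
  proof
    show "((\<lambda>h. G_half \<nu> \<beta> s (x + h *\<^sub>R outward_normal) y) has_vector_derivative
        D + - D + - (s * of_real \<beta> * E 0 + 2 * of_real \<beta> * s * \<Gamma> a)) (at 0)"
      by (rule has_vector_derivative_transform_within_open[OF F', where S="ball 0 a"])
         (use a G_eq in auto)
    show "D + - D + - (s * of_real \<beta> * E 0 + 2 * of_real \<beta> * s * \<Gamma> a) + s * of_real \<beta> * G_half \<nu> \<beta> s x y = 0"
      using G_eq[of 0] a by (simp add: F_def algebra_simps)
  qed
qed

section \<open>Decay along rays\<close>

text \<open>Moving a point of the half-space upwards increases its norm, so the power bound for
  \<open>green\<close> at \<open>z\<close> holds uniformly along the ray and the weight integrates
  to a constant.\<close>

lemma G_imp_bound: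
  obtains C where "\<And>z::(real, 'n) vec. z \<in> half_space \<Longrightarrow> norm (G_imp \<nu> \<beta> s z) \<le> C / norm z ^ CARD('n)"
proof -
  obtain A where A: "A \<ge> 0" "\<And>x::(real, 'n) vec. x \<noteq> 0 \<Longrightarrow> norm (green s x) \<le> A / norm x ^ CARD('n)"
    using green_bound[OF s, where 'a="(real, 'n) vec"] by auto
  let ?I = "\<integral>\<tau>. indicator {0..} \<tau> * exp (- (Re s * \<beta>) * \<tau>) \<partial>lborel"
  show thesis
  proof (rule that[of "norm (- 2 * of_real \<beta> * s) * (A * ?I)"])
    fix z :: "(real, 'n) vec" assume z: "z \<in> half_space"
    then have z0: "z \<noteq> 0" by (rule half_space_nonzero)
    let ?k = "\<lambda>\<tau>. indicator {0..} \<tau> *\<^sub>R (exp (- s * of_real \<beta> * of_real \<tau>) * green s (z + \<tau> *\<^sub>R last_axis))"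
    have le: "norm (?k \<tau>) \<le> A / norm z ^ CARD('n) * (indicator {0..} \<tau> * exp (- (Re s * \<beta>) * \<tau>))" for \<tau>
    proof (cases "\<tau> \<ge> 0")
      case True
      let ?x = "z + \<tau> *\<^sub>R last_axis"
      have "mu z (z $ last_index) \<le> mu z (z $ last_index + \<tau>)"
        using True z by (auto simp: mu_def half_space_def intro!: power_mono)
      then have ge: "norm z \<le> norm ?x"
        by (simp add: mu_eq_norm)
      then have "?x \<noteq> 0" using z0 by auto
      then have "norm (green s ?x) \<le> A / norm ?x ^ CARD('n)" by (rule A)
      also have "\<dots> \<le> A / norm z ^ CARD('n)"
        using ge z0 A(1) by (intro divide_left_mono power_mono mult_pos_pos zero_less_power) auto
      finally have "norm (green s ?x) \<le> A / norm z ^ CARD('n)" .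
      from mult_left_mono[OF this, of "exp (- (Re s * \<beta>) * \<tau>)"] show ?thesis
        using True by (simp add: norm_mult norm_exp_eq_Re mult_ac)
    qed simp
    have "norm (\<integral>\<tau>. ?k \<tau> \<partial>lborel) \<le> (\<integral>\<tau>. A / norm z ^ CARD('n) * (indicator {0..} \<tau> * exp (- (Re s * \<beta>) * \<tau>)) \<partial>lborel)"
    proof (rule order_trans[OF integral_norm_bound], rule integral_mono')
      show "integrable lborel (\<lambda>\<tau>. A / norm z ^ CARD('n) * (indicator {0..} \<tau> * exp (- (Re s * \<beta>) * \<tau>)))"
        by (intro integrable_mult_right integrable_exp_indicator)
    qed (use le A(1) in auto)
    then have "norm (\<integral>\<tau>. ?k \<tau> \<partial>lborel) \<le> A * ?I / norm z ^ CARD('n)"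
      by simp
    from mult_left_mono[OF this norm_ge_zero[of "- 2 * of_real \<beta> * s"]]
    show "norm (G_imp \<nu> \<beta> s z) \<le> norm (- 2 * of_real \<beta> * s) * (A * ?I) / norm z ^ CARD('n)"
      unfolding G_imp_eq_shift[OF nu beta s z]
        norm_mult[of "- 2 * of_real \<beta> * s"]
      by (simp only: times_divide_eq_right)
  qed
qed

text \<open>Each of the three terms is bounded by a negative power of the distance to a fixed point,
  and that distance tends to infinity along the ray because \<open>\<zeta>\<close> is not 0.\<close>

lemma G_half_tendsto_0:
  assumes \<zeta>: "\<zeta> \<in> half_space"
  shows "((\<lambda>\<rho>. G_half \<nu> \<beta> s (\<rho> *\<^sub>R \<zeta>) y) \<longlongrightarrow> 0) at_top"
proof -
  obtain A where A: "\<And>x::(real, 'n) vec. x \<noteq> 0 \<Longrightarrow> norm (green s x) \<le> A / norm x ^ CARD('n)"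
    using green_bound[OF s, where 'a="(real, 'n) vec"] by auto
  obtain C where C: "\<And>z::(real, 'n) vec. z \<in> half_space \<Longrightarrow> norm (G_imp \<nu> \<beta> s z) \<le> C / norm z ^ CARD('n)"
    using G_imp_bound by blast
  have \<zeta>0: "\<zeta> \<noteq> 0" using \<zeta> by (auto simp: half_space_def)
  have far: "filterlim (\<lambda>\<rho>. norm (\<rho> *\<^sub>R \<zeta> - w)) at_top at_top" for w
  proof (rule filterlim_at_top_mono)
    show "filterlim (\<lambda>\<rho>. - norm w + norm \<zeta> * \<rho>) at_top at_top"
      using \<zeta>0 by (intro filterlim_tendsto_add_at_top[OF tendsto_const]
          filterlim_tendsto_pos_mult_at_top[OF tendsto_const] filterlim_ident) auto
    show "\<forall>\<^sub>F \<rho> in at_top. - norm w + norm \<zeta> * \<rho> \<le> norm (\<rho> *\<^sub>R \<zeta> - w)"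
      using eventually_ge_at_top[of 0]
    proof eventually_elim
      fix \<rho> :: real assume "0 \<le> \<rho>"
      then show "- norm w + norm \<zeta> * \<rho> \<le> norm (\<rho> *\<^sub>R \<zeta> - w)"
        using norm_triangle_ineq2[of "\<rho> *\<^sub>R \<zeta>" w] by (simp add: mult.commute)
    qed
  qed
  have lim: "((\<lambda>\<rho>. c / norm (\<rho> *\<^sub>R \<zeta> - w) ^ CARD('n)) \<longlongrightarrow> 0) at_top" for c w
    by (intro tendsto_divide_0[OF tendsto_const] filterlim_at_top_imp_at_infinity filterlim_pow_at_top far) simp
  have g: "((\<lambda>\<rho>. g_full \<nu> s (norm (\<rho> *\<^sub>R \<zeta> - w))) \<longlongrightarrow> 0) at_top" for w
  proof (rule Lim_null_comparison[OF _ lim])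
    show "\<forall>\<^sub>F \<rho> in at_top. norm (g_full \<nu> s (norm (\<rho> *\<^sub>R \<zeta> - w))) \<le> A / norm (\<rho> *\<^sub>R \<zeta> - w) ^ CARD('n)"
      using filterlim_at_top_dense[THEN iffD1, OF far, rule_format, of 0 w]
    proof eventually_elim
      fix \<rho> assume "0 < norm (\<rho> *\<^sub>R \<zeta> - w)"
      then show "norm (g_full \<nu> s (norm (\<rho> *\<^sub>R \<zeta> - w))) \<le> A / norm (\<rho> *\<^sub>R \<zeta> - w) ^ CARD('n)"
        using A[of "\<rho> *\<^sub>R \<zeta> - w"] s nu by (subst g_full_eq_green) auto
    qed
  qed
  have imp: "((\<lambda>\<rho>. G_imp \<nu> \<beta> s (\<rho> *\<^sub>R \<zeta> - reflect y)) \<longlongrightarrow> 0) at_top"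
  proof (rule Lim_null_comparison[OF _ lim])
    show "\<forall>\<^sub>F \<rho> in at_top. norm (G_imp \<nu> \<beta> s (\<rho> *\<^sub>R \<zeta> - reflect y)) \<le> C / norm (\<rho> *\<^sub>R \<zeta> - reflect y) ^ CARD('n)"
      using eventually_ge_at_top[of 0]
    proof eventually_elim
      fix \<rho> :: real assume "0 \<le> \<rho>"
      then show "norm (G_imp \<nu> \<beta> s (\<rho> *\<^sub>R \<zeta> - reflect y)) \<le> C / norm (\<rho> *\<^sub>R \<zeta> - reflect y) ^ CARD('n)"
        using \<zeta> by (intro C diff_reflect_half_space) (simp add: half_space_def)
    qed
  qed
  from tendsto_add[OF tendsto_add[OF g g] imp] show ?thesis
    unfolding G_half_def by simp
qed

end

theorem theorem3p1:
  fixes \<nu> \<beta> :: real and s :: complex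
    and G :: "real^'n::{finite,linorder} \<Rightarrow> real^'n::{finite,linorder} \<Rightarrow> complex"
  assumes d: "CARD('n) \<ge> 2"
    and nu: "\<nu> = (real CARD('n) - 3) / 2"
    and beta: "\<beta> > 0"
    and s: "Re s > 0"
    and G: "G = G_half \<nu> \<beta> s"
  shows
    "(\<forall>y\<in>half_space.
        locally_integrable half_space (\<lambda>x. G x y)
        \<and> (\<forall>\<phi>. test_function half_space \<phi> \<longrightarrow>
             - laplacian_distribution (regular_distribution half_space (\<lambda>x. G x y)) \<phi>
             + s\<^sup>2 * regular_distribution half_space (\<lambda>x. G x y) \<phi> = dirac y \<phi>))
     \<and> (\<forall>x\<in>half_space_boundary. \<forall>y\<in>half_space.
          \<exists>D. ((\<lambda>h. G (x + h *\<^sub>R outward_normal) y) has_vector_derivative D) (at 0)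
              \<and> D + s * of_real \<beta> * G x y = 0)
     \<and> (\<forall>\<zeta>\<in>half_space. \<forall>y\<in>half_space. ((\<lambda>\<rho>. G (\<rho> *\<^sub>R \<zeta>) y) \<longlongrightarrow> 0) at_top)"
  unfolding G
proof (intro conjI ballI allI impI)
  fix x y :: "(real, 'n) vec" assume "x \<in> half_space_boundary" "y \<in> half_space"
  then show "\<exists>D. ((\<lambda>h. G_half \<nu> \<beta> s (x + h *\<^sub>R outward_normal) y) has_vector_derivative D) (at 0)
      \<and> D + s * of_real \<beta> * G_half \<nu> \<beta> s x y = 0"
    by (elim G_half_boundary_condition[OF nu beta s, rotated]) (intro exI conjI)
qed (rule locally_integrable_G_half[OF nu beta s] G_half_distribution[OF nu beta s]
    G_half_tendsto_0[OF nu beta s]; assumption)+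

end
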